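(* Let $B$ be a commutative ring, and let $f(X)$ be a monic polynomial in $B[X]$. The following are equivalent. (1) $f(X)$ is weakly separable in $B[X]$. (2) $f'(X)$ is a non-zero-divisor in $B[X]$ modulo $(f(X))$, i.e. the image of $f'(X)$ in $B[X]/(f(X))$ is a non-zero-divisor of $B[X]/(f(X))$. (3) $\delta(f(X))$ is a non-zero-divisor in $B$.
   Context: Rings have an identity $1$. $f'(X)$ denotes the derivative of $f(X)$ and $\delta(f(X)) \in B$ denotes the (usual) discriminant of the monic polynomial $f(X)$. For a ring extension $A/B$ (with common identity), a $B$-derivation of $A$ (to $A$) is an additive map $\delta: A \to A$ with $\delta(xy)=\delta(x)y+x\delta(y)$ for all $x,y\in A$ and $\delta(\alpha)=0$ for all $\alpha\in B$; it is inner if there is $m\in A$ with $\delta(x)=mx-xm$ for all $x\in A$. The extension $A/B$ is weakly separable if every $B$-derivation of $A$ to $A$ is inner (so for commutative $A$: if every $B$-derivation of $A$ is zero). A monic polynomial $f(X)\in B[X]$ is weakly separable in $B[X]$ if $B[X]/(f(X))$ is weakly separable over $B$. *)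

theory Defs
  imports
    "HOL-Algebra.QuotRing"
    "HOL-Algebra.UnivPoly"
    "HOL-Combinatorics.Permutations"
begin

definition ring_derivation :: "('a, 'm) ring_scheme \<Rightarrow> 'a set \<Rightarrow> ('a \<Rightarrow> 'a) \<Rightarrow> bool" where
  "ring_derivation A K d \<longleftrightarrow>
     d \<in> carrier A \<rightarrow> carrier A \<and>
     (\<forall>x\<in>carrier A. \<forall>y\<in>carrier A. d (x \<oplus>\<^bsub>A\<^esub> y) = d x \<oplus>\<^bsub>A\<^esub> d y) \<and>
     (\<forall>x\<in>carrier A. \<forall>y\<in>carrier A. d (x \<otimes>\<^bsub>A\<^esub> y) = (d x \<otimes>\<^bsub>A\<^esub> y) \<oplus>\<^bsub>A\<^esub> (x \<otimes>\<^bsub>A\<^esub> d y)) \<and>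
     (\<forall>\<alpha>\<in>K. d \<alpha> = \<zero>\<^bsub>A\<^esub>)"

definition inner_derivation :: "('a, 'm) ring_scheme \<Rightarrow> ('a \<Rightarrow> 'a) \<Rightarrow> bool" where
  "inner_derivation A d \<longleftrightarrow>
     (\<exists>m\<in>carrier A. \<forall>x\<in>carrier A. d x = (m \<otimes>\<^bsub>A\<^esub> x) \<ominus>\<^bsub>A\<^esub> (x \<otimes>\<^bsub>A\<^esub> m))"

text \<open>The extension is given by the ring \<open>A\<close> and the subset \<open>K\<close> of its carrier formed by the base ring.\<close>

definition weakly_separable :: "('a, 'm) ring_scheme \<Rightarrow> 'a set \<Rightarrow> bool" where
  "weakly_separable A K \<longleftrightarrow> (\<forall>d. ring_derivation A K d \<longrightarrow> inner_derivation A d)"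

definition non_zero_divisor :: "('a, 'm) ring_scheme \<Rightarrow> 'a \<Rightarrow> bool" where
  "non_zero_divisor R a \<longleftrightarrow> a \<in> carrier R \<and>
     (\<forall>x\<in>carrier R. a \<otimes>\<^bsub>R\<^esub> x = \<zero>\<^bsub>R\<^esub> \<or> x \<otimes>\<^bsub>R\<^esub> a = \<zero>\<^bsub>R\<^esub> \<longrightarrow> x = \<zero>\<^bsub>R\<^esub>)"

definition up_monic :: "('a, 'm) ring_scheme \<Rightarrow> (nat \<Rightarrow> 'a) \<Rightarrow> bool" where
  "up_monic B f \<longleftrightarrow> f \<in> carrier (UP B) \<and> coeff (UP B) f (deg B f) = \<one>\<^bsub>B\<^esub>"

definition up_quot :: "('a, 'm) ring_scheme \<Rightarrow> (nat \<Rightarrow> 'a) \<Rightarrow> (nat \<Rightarrow> 'a) set ring" where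
  "up_quot B f = UP B Quot PIdl\<^bsub>UP B\<^esub> f"

definition up_residue :: "('a, 'm) ring_scheme \<Rightarrow> (nat \<Rightarrow> 'a) \<Rightarrow> (nat \<Rightarrow> 'a) \<Rightarrow> (nat \<Rightarrow> 'a) set" where
  "up_residue B f g = PIdl\<^bsub>UP B\<^esub> f +>\<^bsub>UP B\<^esub> g"

text \<open>For monic \<open>f\<close> of positive degree the constants embed into the quotient, and the base ring is
  identified with its image there; for \<open>f = 1\<close> the quotient is the zero ring.\<close>

definition weakly_separable_poly :: "('a, 'm) ring_scheme \<Rightarrow> (nat \<Rightarrow> 'a) \<Rightarrow> bool" where
  "weakly_separable_poly B f \<longleftrightarrow>
     weakly_separable (up_quot B f) ((\<lambda>b. up_residue B f (monom (UP B) b 0)) ` carrier B)"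

text \<open>Elements of \<open>carrier (UP B)\<close> are the finitely supported coefficient sequences.\<close>

definition up_deriv :: "('a, 'm) ring_scheme \<Rightarrow> (nat \<Rightarrow> 'a) \<Rightarrow> nat \<Rightarrow> 'a" where
  "up_deriv B f = (\<lambda>i. [Suc i] \<cdot>\<^bsub>B\<^esub> coeff (UP B) f (Suc i))"

text \<open>The Leibniz formula, for an \<open>N \<times> N\<close> matrix with entries \<open>M i j\<close>, \<open>i, j < N\<close>.\<close>

definition cring_det :: "('a, 'm) ring_scheme \<Rightarrow> nat \<Rightarrow> (nat \<Rightarrow> nat \<Rightarrow> 'a) \<Rightarrow> 'a" where
  "cring_det B N M =
     (\<Oplus>\<^bsub>B\<^esub>\<pi>\<in>{\<pi>. \<pi> permutes {..<N}}. [sign \<pi>] \<cdot>\<^bsub>B\<^esub> (\<Otimes>\<^bsub>B\<^esub>i\<in>{..<N}. M i (\<pi> i)))"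

text \<open>The Sylvester matrix of \<open>p\<close> and \<open>q\<close>, read as polynomials of formal degrees \<open>m\<close> and \<open>n\<close>:
  its rows are the coefficients, from degree \<open>m + n - 1\<close> downwards, of
  \<open>X\<^bsup>n-1\<^esup> p, \<dots>, X p, p, X\<^bsup>m-1\<^esup> q, \<dots>, X q, q\<close>.\<close>

definition up_sylvester ::
  "('a, 'm) ring_scheme \<Rightarrow> nat \<Rightarrow> nat \<Rightarrow> (nat \<Rightarrow> 'a) \<Rightarrow> (nat \<Rightarrow> 'a) \<Rightarrow> nat \<Rightarrow> nat \<Rightarrow> 'a" where
  "up_sylvester B m n p q i j =
     (if i < n then (if i \<le> j \<and> j \<le> i + m then coeff (UP B) p (m + i - j) else \<zero>\<^bsub>B\<^esub>)
      else (if i - n \<le> j \<and> j \<le> i then coeff (UP B) q (i - j) else \<zero>\<^bsub>B\<^esub>))"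

definition up_resultant ::
  "('a, 'm) ring_scheme \<Rightarrow> nat \<Rightarrow> nat \<Rightarrow> (nat \<Rightarrow> 'a) \<Rightarrow> (nat \<Rightarrow> 'a) \<Rightarrow> 'a" where
  "up_resultant B m n p q = cring_det B (m + n) (up_sylvester B m n p q)"

text \<open>The discriminant \<open>(-1)\<^bsup>n(n-1)/2\<^esup> Res(f, f')\<close> of a monic \<open>f\<close> of degree \<open>n\<close>. The derivative has
  formal degree \<open>n - 1\<close>, although its actual degree may be smaller, so that the value is the
  universal polynomial in the coefficients of \<open>f\<close>. For \<open>f = 1\<close> it is the empty determinant \<open>1\<close>.\<close>

definition up_disc :: "('a, 'm) ring_scheme \<Rightarrow> (nat \<Rightarrow> 'a) \<Rightarrow> 'a" where
  "up_disc B f = (let n = deg B f in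
     [((-1 :: int) ^ (n * (n - 1) div 2))] \<cdot>\<^bsub>B\<^esub> up_resultant B n (n - 1) f (up_deriv B f))"

end

theory Submission
  imports Defs
begin

text \<open>Write \<open>A = B[X]/(f)\<close>, \<open>x\<close> for the image of \<open>X\<close> in \<open>A\<close>, and \<open>m\<close> for the degree of \<open>f\<close>.

A \<open>B\<close>-derivation \<open>d\<close> of \<open>A\<close> is determined by \<open>a = d x\<close>, because \<open>d (g(x)) = g'(x) a\<close> for every
polynomial \<open>g\<close> (\<open>derivation_chain_rule\<close>). Taking \<open>g = f\<close> gives \<open>f'(x) a = 0\<close>. Conversely, if \<open>f'(x) a = 0\<close>,
then \<open>g(x) \<mapsto> g'(x) a\<close> is well defined, since \<open>(s f)'(x) a = s(x) f'(x) a = 0\<close>, and it is a derivation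
(\<open>derivation_of_annihilator\<close>). So the derivations of \<open>A\<close> correspond to the annihilator of \<open>f'(x)\<close>.
As \<open>A\<close> is commutative, its only inner derivation is zero; hence \<open>f\<close> is weakly separable exactly when
that annihilator vanishes, that is, when \<open>f'(x)\<close> is a non-zero-divisor.

For \<open>m = 0\<close> the ring \<open>A\<close> is zero and the discriminant is an empty determinant.
Otherwise, up to sign, the discriminant is the determinant of the Sylvester matrix of \<open>f\<close> and \<open>q = f'\<close>.
A row vector times this matrix lists the coefficients of \<open>u f + w q\<close>, where the entries of the vector are the coefficients of a
polynomial \<open>u\<close> of degree less than \<open>m - 1\<close> and of a polynomial \<open>w\<close> of degree less than \<open>m\<close>
(\<open>sylvester_row_combination\<close>). As \<open>f\<close> is monic, every residue class modulo \<open>f\<close> contains exactly one such \<open>w\<close>, and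
whenever \<open>w q\<close> is a multiple of \<open>f\<close>, the cofactor has degree less than \<open>m - 1\<close>.
Therefore the left kernel of the matrix is trivial exactly when \<open>q\<close> is a non-zero-divisor modulo \<open>f\<close>
(\<open>monic_resultant_nzd_iff\<close>).

What connects the two is McCoy's theorem: over any commutative ring, a square matrix has trivial left kernel if and only if
its determinant is a non-zero-divisor (\<open>det_nzd_iff_left_kernel_trivial\<close>). It rests on Cramer's rule in one
direction and on a suitably chosen minor in the other, for which the
multilinear and alternating properties of the Leibniz determinant are derived first.\<close>

section \<open>Determinants over a commutative ring\<close>

lemma permutes_lessThan: "p permutes {..<N} \<Longrightarrow> i < N \<Longrightarrow> p i < (N :: nat)"
  using permutes_in_image[of p "{..<N}" i] by simp

context cring
begin

lemma sign_mult_closed [simp, intro]: "x \<in> carrier R \<Longrightarrow> [sign p] \<cdot> x \<in> carrier R"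
  by (rule add.int_pow_closed)

lemma sign_mult_comp:
  assumes "permutation p" "permutation q" "x \<in> carrier R"
  shows "[sign (p \<circ> q)] \<cdot> x = [sign p] \<cdot> ([sign q] \<cdot> x)"
  using assms by (simp add: sign_compose add.int_pow_pow mult.commute)

lemma sign_mult_rdistr:
  "x \<in> carrier R \<Longrightarrow> y \<in> carrier R \<Longrightarrow> [sign p] \<cdot> (x \<otimes> y) = x \<otimes> ([sign p] \<cdot> y)"
  by (simp add: add_pow_rdistr_int)

lemma sign_mult_add:
  "x \<in> carrier R \<Longrightarrow> y \<in> carrier R \<Longrightarrow> [sign p] \<cdot> (x \<oplus> y) = [sign p] \<cdot> x \<oplus> [sign p] \<cdot> y"
  by (rule add.int_pow_distrib)

lemma finsum_sign_mult:
  assumes "finite S" "\<And>x. x \<in> S \<Longrightarrow> F x \<in> carrier R"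
  shows "[sign p] \<cdot> (\<Oplus>x\<in>S. F x) = (\<Oplus>x\<in>S. [sign p] \<cdot> F x)"
  using assms
proof (induction S rule: finite_induct)
  case empty
  then show ?case by (simp add: sign_def add.int_pow_one)
next
  case (insert a S)
  then show ?case by (simp add: Pi_def sign_mult_add)
qed

lemma det_term_closed:
  assumes "\<And>i j. i < N \<Longrightarrow> j < N \<Longrightarrow> M i j \<in> carrier R" "p permutes {..<N}"
  shows "(\<Otimes>i\<in>{..<N}. M i (p i)) \<in> carrier R"
  using assms permutes_in_image[OF assms(2)] by (intro finprod_closed) auto

lemma det_closed:
  assumes "\<And>i j. i < N \<Longrightarrow> j < N \<Longrightarrow> M i j \<in> carrier R"
  shows "cring_det R N M \<in> carrier R"
  unfolding cring_det_def using det_term_closed[of N M, OF assms] by (intro finsum_closed) auto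

lemma det_cong:
  assumes "\<And>i j. i < N \<Longrightarrow> j < N \<Longrightarrow> M' i j \<in> carrier R"
    and "\<And>i j. i < N \<Longrightarrow> j < N \<Longrightarrow> M i j = M' i j"
  shows "cring_det R N M = cring_det R N M'"
proof -
  have "(\<Otimes>i\<in>{..<N}. M i (p i)) = (\<Otimes>i\<in>{..<N}. M' i (p i))" if "p permutes {..<N}" for p
    using assms permutes_in_image[OF that] by (intro finprod_cong') auto
  then show ?thesis
    unfolding cring_det_def using det_term_closed[of N M', OF assms(1)] by (intro finsum_cong') auto
qed

lemma det_transpose:
  assumes M: "\<And>i j. i < N \<Longrightarrow> j < N \<Longrightarrow> M i j \<in> carrier R"
  shows "cring_det R N (\<lambda>i j. M j i) = cring_det R N M"
proof -
  let ?P = "{p. p permutes {..<N}}"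
  let ?F = "\<lambda>p. [sign p] \<cdot> (\<Otimes>i\<in>{..<N}. M i (p i))"
  have F: "?F \<in> ?P \<rightarrow> carrier R"
    using det_term_closed[of N M, OF M] by auto
  have img: "inv_into UNIV ` ?P = ?P"
    using image_inverse_permutations by blast
  have inj: "inj_on (inv_into UNIV) ?P"
    by (metis (mono_tags, lifting) inj_on_def mem_Collect_eq permutes_inv_inv)
  have "cring_det R N M = (\<Oplus>p\<in>inv_into UNIV ` ?P. ?F p)"
    by (simp add: cring_det_def img)
  also have "\<dots> = (\<Oplus>p\<in>?P. ?F (inv_into UNIV p))"
    using F inj by (intro finsum_reindex) (auto simp: img simp del: image_subset_iff_funcset)
  also have "\<dots> = (\<Oplus>p\<in>?P. [sign p] \<cdot> (\<Otimes>i\<in>{..<N}. M (p i) i))"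
  proof (rule finsum_cong')
    fix p assume "p \<in> ?P"
    then have p: "p permutes {..<N}" by simp
    have "(\<Otimes>i\<in>{..<N}. M i (inv_into UNIV p i)) = (\<Otimes>i\<in>p ` {..<N}. M i (inv_into UNIV p i))"
      by (simp add: permutes_image[OF p])
    also have "\<dots> = (\<Otimes>i\<in>{..<N}. M (p i) (inv_into UNIV p (p i)))"
      using permutes_inj_on[OF p] M permutes_in_image[OF permutes_inv[OF p]]
      by (intro finprod_reindex) (auto simp: permutes_image[OF p])
    also have "\<dots> = (\<Otimes>i\<in>{..<N}. M (p i) i)"
      by (simp add: permutes_inverses(2)[OF p])
    finally show "?F (inv_into UNIV p) = [sign p] \<cdot> (\<Otimes>i\<in>{..<N}. M (p i) i)"
      using p by (simp add: sign_inverse permutation_permutes[of p] exI[of _ "{..<N}"])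
  next
    show "(\<lambda>p. [sign p] \<cdot> (\<Otimes>i\<in>{..<N}. M (p i) i)) \<in> ?P \<rightarrow> carrier R"
      using M by (auto intro!: sign_mult_closed finprod_closed simp: permutes_lessThan)
  qed simp
  finally show ?thesis by (simp add: cring_det_def)
qed

lemma det_permute_rows:
  assumes M: "\<And>i j. i < N \<Longrightarrow> j < N \<Longrightarrow> M i j \<in> carrier R" and r: "r permutes {..<N}"
  shows "cring_det R N (\<lambda>i j. M (r i) j) = [sign r] \<cdot> cring_det R N M"
proof -
  let ?P = "{p. p permutes {..<N}}"
  let ?T = "\<lambda>p. (\<Otimes>i\<in>{..<N}. M i (p i))"
  let ?F = "\<lambda>p. [sign p] \<cdot> (\<Otimes>i\<in>{..<N}. M (r i) (p i))"
  have rl: "r i < N" if "i < N" for i using that permutes_in_image[OF r] by simp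
  have F: "?F \<in> ?P \<rightarrow> carrier R"
    using det_term_closed[of N "\<lambda>i. M (r i)"] M rl by auto
  have img: "(\<lambda>p. p \<circ> r) ` ?P = ?P"
    using image_compose_permutations_right[OF r] by (auto simp: comp_def)
  have inj: "inj_on (\<lambda>p. p \<circ> r) ?P"
    using r by (auto simp: inj_on_def fun_eq_iff) (metis permutes_inverses(1))
  have "cring_det R N (\<lambda>i j. M (r i) j) = (\<Oplus>p\<in>(\<lambda>p. p \<circ> r) ` ?P. ?F p)"
    by (simp only: cring_det_def img)
  also have "\<dots> = (\<Oplus>p\<in>?P. ?F (p \<circ> r))"
    using F inj by (intro finsum_reindex) (simp_all only: img)
  also have "\<dots> = (\<Oplus>p\<in>?P. [sign r] \<cdot> ([sign p] \<cdot> ?T p))"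
  proof (rule finsum_cong')
    fix p assume "p \<in> ?P"
    then have p: "p permutes {..<N}" by simp
    have "?T p = (\<Otimes>i\<in>r ` {..<N}. M i (p i))"
      by (simp add: permutes_image[OF r])
    also have "\<dots> = (\<Otimes>i\<in>{..<N}. M (r i) (p (r i)))"
      using permutes_inj_on[OF r] M permutes_in_image[OF p]
      by (intro finprod_reindex) (auto simp: permutes_image[OF r])
    finally have "(\<Otimes>i\<in>{..<N}. M (r i) ((p \<circ> r) i)) = ?T p" by simp
    moreover have "sign (p \<circ> r) = sign (r \<circ> p)"
      using p r by (metis finite_lessThan mult.commute permutation_permutes sign_compose)
    moreover have "permutation p" "permutation r"
      using p r finite_lessThan permutation_permutes by blast+
    ultimately show "?F (p \<circ> r) = [sign r] \<cdot> ([sign p] \<cdot> ?T p)"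
      using det_term_closed[of N M, OF M p] by (simp only: sign_mult_comp)
  next
    show "(\<lambda>p. [sign r] \<cdot> ([sign p] \<cdot> ?T p)) \<in> ?P \<rightarrow> carrier R"
      using det_term_closed[of N M, OF M] by auto
  qed simp
  also have "\<dots> = [sign r] \<cdot> cring_det R N M"
    unfolding cring_det_def using det_term_closed[of N M, OF M]
    by (intro finsum_sign_mult[symmetric]) (auto simp: finite_permutations)
  finally show ?thesis .
qed

text \<open>Composition with the transposition of the two equal rows matches each even permutation with an odd one
that contributes the same product, so the Leibniz terms cancel in pairs. Arguing from \<open>det M = - det M\<close>
would not do, because 2 may be a zero divisor.\<close>

lemma det_repeated_row:
  assumes M: "\<And>i j. i < N \<Longrightarrow> j < N \<Longrightarrow> M i j \<in> carrier R"
    and ik: "i < N" "k < N" "i \<noteq> k" and eq: "\<And>j. j < N \<Longrightarrow> M i j = M k j"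
  shows "cring_det R N M = \<zero>"
proof -
  define t where "t = Transposition.transpose i k"
  have t: "t permutes {..<N}" unfolding t_def using ik by (simp add: permutes_swap_id)
  have tt: "t \<circ> t = id" by (auto simp: t_def)
  let ?E = "{p. p permutes {..<N} \<and> evenperm p}"
  let ?O = "{p. p permutes {..<N} \<and> \<not> evenperm p}"
  let ?T = "\<lambda>p. (\<Otimes>i\<in>{..<N}. M i (p i))"
  let ?F = "\<lambda>p. [sign p] \<cdot> ?T p"
  have perm: "permutation p" if "p permutes {..<N}" for p
    using that finite_lessThan permutation_permutes by blast
  have evt: "evenperm (p \<circ> t) \<longleftrightarrow> \<not> evenperm p" if "p permutes {..<N}" for p
    using perm[OF that] perm[OF t] ik by (simp add: evenperm_comp t_def evenperm_swap)
  have O: "?O = (\<lambda>p. p \<circ> t) ` ?E"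
  proof (intro equalityI subsetI)
    fix p assume "p \<in> ?O"
    then have p: "p permutes {..<N}" "\<not> evenperm p" by auto
    have "p = (p \<circ> t) \<circ> t" using tt by (simp add: comp_assoc)
    moreover have "p \<circ> t \<in> ?E" using p evt permutes_compose[OF t] by auto
    ultimately show "p \<in> (\<lambda>p. p \<circ> t) ` ?E" by blast
  qed (use evt permutes_compose[OF t] in auto)
  have inj: "inj_on (\<lambda>p. p \<circ> t) ?E"
    using t by (auto simp: inj_on_def fun_eq_iff) (metis permutes_inverses(1))
  have Tt: "?T (p \<circ> t) = ?T p" if p: "p permutes {..<N}" for p
  proof -
    have "?T p = (\<Otimes>i\<in>t ` {..<N}. M i (p i))"
      by (simp add: permutes_image[OF t])
    also have "\<dots> = (\<Otimes>i\<in>{..<N}. M (t i) (p (t i)))"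
      using permutes_inj_on[OF t] M permutes_in_image[OF p]
      by (intro finprod_reindex) (auto simp: permutes_image[OF t])
    also have "\<dots> = (\<Otimes>i\<in>{..<N}. M i (p (t i)))"
    proof (rule finprod_cong')
      show "(\<lambda>i. M i (p (t i))) \<in> {..<N} \<rightarrow> carrier R"
        using M permutes_in_image[OF p] permutes_in_image[OF t] by auto
      fix l assume "l \<in> {..<N}"
      then have "p (t l) < N" using permutes_in_image[OF p] permutes_in_image[OF t] by auto
      then show "M (t l) (p (t l)) = M l (p (t l))"
        using eq by (auto simp: t_def Transposition.transpose_def)
    qed simp
    finally show ?thesis by simp
  qed
  have TE: "?T p \<in> carrier R" if "p permutes {..<N}" for p
    using det_term_closed[of N M, OF M that] .
  have fin: "finite ?E" "finite ?O"
    using finite_permutations[of "{..<N}"] by (auto intro: finite_subset)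
  have "cring_det R N M = (\<Oplus>p\<in>?E \<union> ?O. ?F p)"
    unfolding cring_det_def by (rule arg_cong[where f = "finsum R _"]) auto
  also have "\<dots> = (\<Oplus>p\<in>?E. ?F p) \<oplus> (\<Oplus>p\<in>?O. ?F p)"
    using fin TE by (intro finsum_Un_disjoint) auto
  also have "(\<Oplus>p\<in>?O. ?F p) = (\<Oplus>p\<in>?E. ?F (p \<circ> t))"
    unfolding O using inj TE permutes_compose[OF t] by (intro finsum_reindex) auto
  also have "(\<Oplus>p\<in>?E. ?F p) \<oplus> (\<Oplus>p\<in>?E. ?F (p \<circ> t)) = (\<Oplus>p\<in>?E. ?F p \<oplus> ?F (p \<circ> t))"
    using TE TE[OF permutes_compose[OF t]] by (intro finsum_addf[symmetric]) auto
  also have "\<dots> = \<zero>"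
  proof (rule add.finprod_one_eqI)
    fix p assume "p \<in> ?E"
    then have p: "p permutes {..<N}" "evenperm p" by auto
    then have "sign p = 1" "sign (p \<circ> t) = -1" using evt by (auto simp: sign_def)
    then show "?F p \<oplus> ?F (p \<circ> t) = \<zero>"
      using TE[OF p(1)] by (simp only: Tt[OF p(1)]) (simp add: add.int_pow_neg r_neg)
  qed
  finally show ?thesis .
qed

text \<open>The factor that comes from row \<open>k\<close> is isolated in each Leibniz term; the remaining factor does not
depend on that row, which makes linearity in the row visible.\<close>

lemma det_split_row:
  assumes M: "\<And>i j. i < N \<Longrightarrow> j < N \<Longrightarrow> M i j \<in> carrier R" and k: "k < N"
    and r: "\<And>j. j < N \<Longrightarrow> r j \<in> carrier R"
  shows "cring_det R N (M(k := r)) =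
    (\<Oplus>p\<in>{p. p permutes {..<N}}. r (p k) \<otimes> ([sign p] \<cdot> (\<Otimes>i\<in>{..<N} - {k}. M i (p i))))"
  unfolding cring_det_def
proof (rule finsum_cong')
  fix p assume "p \<in> {p. p permutes {..<N}}"
  then have p: "p permutes {..<N}" by simp
  have pl: "p i < N" if "i < N" for i using that permutes_in_image[OF p] by simp
  have Mp: "M i (p i) \<in> carrier R" if "i < N" for i
    using M pl that by simp
  have c: "(\<Otimes>i\<in>{..<N} - {k}. M i (p i)) \<in> carrier R"
    using Mp by (intro finprod_closed) auto
  have "(\<Otimes>i\<in>{..<N}. (M(k := r)) i (p i)) = (\<Otimes>i\<in>insert k ({..<N} - {k}). (M(k := r)) i (p i))"
    using k by (simp add: insert_absorb)
  also have "\<dots> = r (p k) \<otimes> (\<Otimes>i\<in>{..<N} - {k}. (M(k := r)) i (p i))"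
    using Mp r pl k by (subst finprod_insert) auto
  also have "(\<Otimes>i\<in>{..<N} - {k}. (M(k := r)) i (p i)) = (\<Otimes>i\<in>{..<N} - {k}. M i (p i))"
    using Mp by (intro finprod_cong') auto
  finally show "[sign p] \<cdot> (\<Otimes>i\<in>{..<N}. (M(k := r)) i (p i)) =
    r (p k) \<otimes> ([sign p] \<cdot> (\<Otimes>i\<in>{..<N} - {k}. M i (p i)))"
    using c r pl k by (simp add: sign_mult_rdistr)
next
  show "(\<lambda>p. r (p k) \<otimes> ([sign p] \<cdot> (\<Otimes>i\<in>{..<N} - {k}. M i (p i))))
    \<in> {p. p permutes {..<N}} \<rightarrow> carrier R"
    using M r k by (auto intro!: m_closed sign_mult_closed finprod_closed simp: permutes_lessThan)
qed simp

lemma det_row_linear: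
  assumes M: "\<And>i j. i < N \<Longrightarrow> j < N \<Longrightarrow> M i j \<in> carrier R" and k: "k < N"
    and S: "finite S" and a: "\<And>s. s \<in> S \<Longrightarrow> a s \<in> carrier R"
    and r: "\<And>s j. s \<in> S \<Longrightarrow> j < N \<Longrightarrow> r s j \<in> carrier R"
  shows "cring_det R N (M(k := \<lambda>j. \<Oplus>s\<in>S. a s \<otimes> r s j)) =
    (\<Oplus>s\<in>S. a s \<otimes> cring_det R N (M(k := r s)))"
proof -
  let ?P = "{p. p permutes {..<N}}"
  let ?C = "\<lambda>p. [sign p] \<cdot> (\<Otimes>i\<in>{..<N} - {k}. M i (p i))"
  have C: "?C p \<in> carrier R" if "p permutes {..<N}" for p
    using M that by (intro sign_mult_closed finprod_closed) (auto simp: permutes_lessThan)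
  have pk: "p k < N" if "p permutes {..<N}" for p
    using k that by (simp add: permutes_lessThan)
  show ?thesis
    using S a r
  proof (induction S rule: finite_induct)
    case empty
    have "(\<Oplus>p\<in>?P. \<zero> \<otimes> ?C p) = \<zero>"
      using C by (intro add.finprod_one_eqI) auto
    moreover have "cring_det R N (M(k := \<lambda>_. \<zero>)) = (\<Oplus>p\<in>?P. \<zero> \<otimes> ?C p)"
      by (intro det_split_row[OF M k]) auto
    ultimately show ?case by (simp only: finsum_empty)
  next
    case (insert t T)
    let ?R = "\<lambda>j. \<Oplus>s\<in>T. a s \<otimes> r s j"
    have R: "?R j \<in> carrier R" if "j < N" for j
      using insert.prems that by (intro finsum_closed) auto
    have as: "a t \<in> carrier R" using insert.prems by simp
    have rs: "r t j \<in> carrier R" if "j < N" for j using insert.prems that by simp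
    have closed: "cring_det R N (M(k := r s)) \<in> carrier R" if "s \<in> insert t T" for s
      using M insert.prems that by (intro det_closed) auto
    have "cring_det R N (M(k := \<lambda>j. \<Oplus>s\<in>insert t T. a s \<otimes> r s j)) =
      cring_det R N (M(k := \<lambda>j. a t \<otimes> r t j \<oplus> ?R j))"
      using insert R as rs M by (intro det_cong) (auto simp: Pi_def)
    also have "\<dots> = (\<Oplus>p\<in>?P. (a t \<otimes> r t (p k) \<oplus> ?R (p k)) \<otimes> ?C p)"
      using R as rs by (intro det_split_row[OF M k]) auto
    also have "\<dots> = (\<Oplus>p\<in>?P. a t \<otimes> (r t (p k) \<otimes> ?C p) \<oplus> ?R (p k) \<otimes> ?C p)"
      using R as rs C pk by (intro finsum_cong') (auto simp: l_distr m_assoc)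
    also have "\<dots> = (\<Oplus>p\<in>?P. a t \<otimes> (r t (p k) \<otimes> ?C p)) \<oplus> (\<Oplus>p\<in>?P. ?R (p k) \<otimes> ?C p)"
      using R as rs C pk by (intro finsum_addf) auto
    also have "(\<Oplus>p\<in>?P. ?R (p k) \<otimes> ?C p) = cring_det R N (M(k := ?R))"
      using R by (intro det_split_row[OF M k, symmetric]) auto
    also have "(\<Oplus>p\<in>?P. a t \<otimes> (r t (p k) \<otimes> ?C p)) = a t \<otimes> (\<Oplus>p\<in>?P. r t (p k) \<otimes> ?C p)"
      using as rs C pk by (intro finsum_rdistr[symmetric]) (auto simp: finite_permutations)
    also have "(\<Oplus>p\<in>?P. r t (p k) \<otimes> ?C p) = cring_det R N (M(k := r t))"
      using rs by (intro det_split_row[OF M k, symmetric]) auto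
    finally have "cring_det R N (M(k := \<lambda>j. \<Oplus>s\<in>insert t T. a s \<otimes> r s j)) =
      a t \<otimes> cring_det R N (M(k := r t)) \<oplus> cring_det R N (M(k := ?R))" .
    also have "cring_det R N (M(k := ?R)) = (\<Oplus>s\<in>T. a s \<otimes> cring_det R N (M(k := r s)))"
      by (rule insert.IH) (use insert.prems in auto)
    also have "a t \<otimes> cring_det R N (M(k := r t)) \<oplus>
        (\<Oplus>s\<in>T. a s \<otimes> cring_det R N (M(k := r s))) =
        (\<Oplus>s\<in>insert t T. a s \<otimes> cring_det R N (M(k := r s)))"
      using insert.hyps insert.prems closed by (intro finsum_insert[symmetric]) auto
    finally show ?case .
  qed
qed

text \<open>Cramer's rule: replace row \<open>k\<close> by the combination of the rows with coefficients \<open>v\<close>. The new row is zero, while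
by linearity and alternation the determinant of the new matrix is \<open>v k\<close> times that of \<open>M\<close>.\<close>

lemma det_nzd_imp_left_kernel_trivial:
  assumes M: "\<And>i j. i < N \<Longrightarrow> j < N \<Longrightarrow> M i j \<in> carrier R"
    and nzd: "non_zero_divisor R (cring_det R N M)"
    and v: "\<And>i. i < N \<Longrightarrow> v i \<in> carrier R"
    and ker: "\<And>j. j < N \<Longrightarrow> (\<Oplus>i\<in>{..<N}. v i \<otimes> M i j) = \<zero>"
    and k: "k < N"
  shows "v k = \<zero>"
proof -
  let ?D = "\<lambda>i. cring_det R N (M(k := M i))"
  have D: "?D i \<in> carrier R" if "i < N" for i
    using M that by (intro det_closed) auto
  have D0: "?D i = \<zero>" if "i < N" "i \<noteq> k" for i
    using M that k by (intro det_repeated_row[of N _ i k]) auto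
  have "\<zero> = (\<Oplus>s\<in>({} :: nat set). \<zero> \<otimes> cring_det R N (M(k := \<lambda>_. \<zero>)))" by (simp only: finsum_empty)
  also have "\<dots> = cring_det R N (M(k := \<lambda>j. \<Oplus>s\<in>({} :: nat set). \<zero> \<otimes> \<zero>))"
    using M k by (intro det_row_linear[symmetric]) auto
  also have "\<dots> = cring_det R N (M(k := \<lambda>j. \<Oplus>i\<in>{..<N}. v i \<otimes> M i j))"
    using M ker by (intro det_cong) auto
  also have "\<dots> = (\<Oplus>i\<in>{..<N}. v i \<otimes> ?D i)"
    using M k v by (intro det_row_linear) auto
  also have "\<dots> = (\<Oplus>i\<in>{..<N}. if k = i then v i \<otimes> ?D i else \<zero>)"
    using v D D0 det_closed[of N M, OF M] by (intro finsum_cong') auto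
  also have "\<dots> = v k \<otimes> ?D k"
    using k v D det_closed[of N M, OF M] by (intro finsum_singleton) auto
  finally have "v k \<otimes> cring_det R N M = \<zero>" by simp
  then show ?thesis
    using nzd v[OF k] unfolding non_zero_divisor_def by blast
qed

text \<open>The corner case of Laplace expansion: only the permutations that fix \<open>r\<close> contribute.\<close>

lemma det_unit_last_row:
  assumes M: "\<And>i j. i < r \<Longrightarrow> j < r \<Longrightarrow> M i j \<in> carrier R"
    and col: "\<And>i. i < r \<Longrightarrow> M i r \<in> carrier R"
    and last: "\<And>j. j \<le> r \<Longrightarrow> M r j = (if j = r then \<one> else \<zero>)"
  shows "cring_det R (Suc r) M = cring_det R r M"
proof -
  let ?P = "{p. p permutes {..<Suc r}}"
  let ?Q = "{p. p permutes {..<r}}"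
  have M': "M i j \<in> carrier R" if "i < Suc r" "j < Suc r" for i j
    using that M col last by (cases "i = r"; cases "j = r") auto
  have step: "(\<Otimes>i\<in>{..<Suc r}. M i (p i)) = M r (p r) \<otimes> (\<Otimes>i\<in>{..<r}. M i (p i))"
    if "p permutes {..<Suc r}" for p
    unfolding lessThan_Suc
    using M' permutes_lessThan[OF that] by (intro finprod_insert) auto
  show ?thesis
    unfolding cring_det_def
  proof (rule add.finprod_mono_neutral_cong_right)
    show "finite ?P" by (simp add: finite_permutations)
    show "?Q \<subseteq> ?P" by (auto intro: permutes_subset)
    show "(\<lambda>p. [sign p] \<cdot> (\<Otimes>i\<in>{..<Suc r}. M i (p i))) \<in> ?P \<rightarrow> carrier R"
      using det_term_closed[of "Suc r" M, OF M'] by auto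
  next
    fix p assume "p \<in> ?P - ?Q"
    then have p: "p permutes {..<Suc r}" "\<not> p permutes {..<r}" by auto
    have "p r \<noteq> r"
    proof
      assume "p r = r"
      then have "p permutes {..<Suc r} - {r}"
        using p(1) by (intro permutes_superset[OF p(1)]) auto
      moreover have "{..<Suc r} - {r} = {..<r}" by auto
      ultimately show False using p(2) by simp
    qed
    moreover have "p r < Suc r" using permutes_lessThan[OF p(1)] by simp
    ultimately have "M r (p r) = \<zero>" using last by simp
    moreover have "(\<Otimes>i\<in>{..<r}. M i (p i)) \<in> carrier R"
      using M' permutes_lessThan[OF p(1)] by (intro finprod_closed) auto
    ultimately show "[sign p] \<cdot> (\<Otimes>i\<in>{..<Suc r}. M i (p i)) = \<zero>"
      by (simp only: step[OF p(1)]) (simp add: add.int_pow_one)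
  next
    fix p assume "p \<in> ?Q"
    then have p: "p permutes {..<r}" by simp
    then have "p r = r" by (simp add: permutes_not_in)
    moreover have "p permutes {..<Suc r}" using p by (rule permutes_subset) auto
    ultimately show "[sign p] \<cdot> (\<Otimes>i\<in>{..<Suc r}. M i (p i)) = [sign p] \<cdot> (\<Otimes>i\<in>{..<r}. M i (p i))"
      using det_term_closed[of r M, OF M p] last by (simp only: step) simp
  qed
qed

text \<open>A selection of \<open>N\<close> rows and columns either repeats a row or permutes both rows and columns, so its
determinant is zero or \<open>\<plusminus> det M\<close>.\<close>

lemma det_select_vanishes:
  assumes M: "\<And>i j. i < N \<Longrightarrow> j < N \<Longrightarrow> M i j \<in> carrier R" and c: "c \<in> carrier R"
    and cdet: "c \<otimes> cring_det R N M = \<zero>"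
    and row: "\<And>i. i < N \<Longrightarrow> row i < N" and col: "\<And>j. j < N \<Longrightarrow> col j < N"
    and inj: "inj_on col {..<N}"
  shows "c \<otimes> cring_det R N (\<lambda>i j. M (row i) (col j)) = \<zero>"
proof (cases "inj_on row {..<N}")
  case False
  then obtain i k where "i < N" "k < N" "i \<noteq> k" "row i = row k"
    by (auto simp: inj_on_def)
  then have "cring_det R N (\<lambda>i j. M (row i) (col j)) = \<zero>"
    using M row col by (intro det_repeated_row[of N _ i k]) auto
  then show ?thesis using c by simp
next
  case True
  have ext: "\<exists>p. p permutes {..<N} \<and> (\<forall>i<N. p i = h i)"
    if h: "\<And>i. i < N \<Longrightarrow> h i < N" "inj_on h {..<N}" for h
  proof (intro exI conjI)
    let ?p = "\<lambda>i. if i < N then h i else i"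
    have "h ` {..<N} = {..<N}"
      using h by (intro endo_inj_surj) auto
    then have "bij_betw ?p {..<N} {..<N}"
      using h(2) by (auto simp: bij_betw_def inj_on_def)
    then show "?p permutes {..<N}" by (rule bij_imp_permutes) auto
  qed auto
  obtain p where p: "p permutes {..<N}" "\<And>i. i < N \<Longrightarrow> p i = row i"
    using ext[OF row True] by auto
  obtain q where q: "q permutes {..<N}" "\<And>i. i < N \<Longrightarrow> q i = col i"
    using ext[OF col inj] by auto
  have "cring_det R N (\<lambda>i j. M (row i) (col j)) = cring_det R N (\<lambda>i j. M (p i) (q j))"
    using M p q row col by (intro det_cong) auto
  also have "\<dots> = [sign p] \<cdot> cring_det R N (\<lambda>i j. M i (q j))"
    using M permutes_lessThan[OF q(1)] by (intro det_permute_rows[OF _ p(1)]) auto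
  also have "cring_det R N (\<lambda>i j. M i (q j)) = cring_det R N (\<lambda>i j. M j (q i))"
    using M permutes_lessThan[OF q(1)] by (intro det_transpose) auto
  also have "\<dots> = [sign q] \<cdot> cring_det R N (\<lambda>i j. M j i)"
    using M by (intro det_permute_rows[OF _ q(1)]) auto
  also have "cring_det R N (\<lambda>i j. M j i) = cring_det R N M"
    using M by (intro det_transpose) auto
  finally have "c \<otimes> cring_det R N (\<lambda>i j. M (row i) (col j)) =
      [sign p] \<cdot> ([sign q] \<cdot> (c \<otimes> cring_det R N M))"
    using c det_closed[of N M, OF M] by (simp add: sign_mult_rdistr)
  then show ?thesis by (simp add: cdet add.int_pow_one)
qed

text \<open>The harder half of McCoy's theorem. If \<open>c\<close> kills the determinant, there is an \<open>r < N\<close> such that \<open>c\<close> does not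
kill some \<open>r\<close>-rowed minor but kills all \<open>(r + 1)\<close>-rowed ones. Border such an \<open>r\<close>-rowed minor by a new column \<open>k\<close>
and by an arbitrary row \<open>i\<close> of \<open>M\<close>: expansion along the bordering row shows that the cofactors of that row, multiplied by \<open>c\<close>
and placed at the selected columns, form a vector that is orthogonal to every row of \<open>M\<close>. Its entry in column \<open>k\<close>
is \<open>c\<close> times the chosen minor, hence nonzero.\<close>

lemma det_zero_divisor_imp_right_kernel:
  assumes M: "\<And>i j. i < N \<Longrightarrow> j < N \<Longrightarrow> M i j \<in> carrier R"
    and c: "c \<in> carrier R" "c \<noteq> \<zero>" and cdet: "c \<otimes> cring_det R N M = \<zero>"
  obtains v where "\<And>j. j < N \<Longrightarrow> v j \<in> carrier R"
    "\<And>i. i < N \<Longrightarrow> (\<Oplus>j\<in>{..<N}. M i j \<otimes> v j) = \<zero>" "\<exists>j<N. v j \<noteq> \<zero>"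
proof -
  \<comment> \<open>The column selection has to be injective, so that the cofactors can be placed at distinct
    coordinates.\<close>
  define alive_minor where "alive_minor r \<longleftrightarrow> (\<exists>row col. (\<forall>i<r. row i < N) \<and> (\<forall>j<r. col j < N) \<and>
    inj_on col {..<r} \<and> c \<otimes> cring_det R r (\<lambda>i j. M (row i) (col j)) \<noteq> \<zero>)" for r
  have "alive_minor 0" using c by (simp add: alive_minor_def cring_det_def sign_id)
  moreover have "\<not> alive_minor N"
  proof
    assume "alive_minor N"
    then obtain row col where "\<forall>i<N. row i < N" "\<forall>j<N. col j < N" "inj_on col {..<N}"
      and "c \<otimes> cring_det R N (\<lambda>i j. M (row i) (col j)) \<noteq> \<zero>"
      unfolding alive_minor_def by (elim exE conjE) (rule that)
    then show False
      using det_select_vanishes[of N M c row col, OF M c(1) cdet] by simp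
  qed
  ultimately obtain r where r: "r < N" "alive_minor r" "\<not> alive_minor (Suc r)"
    using ex_least_nat_less[of "\<lambda>r. \<not> alive_minor r" N] by auto
  obtain row col where rc: "\<forall>i<r. row i < N" "\<forall>j<r. col j < N"
    and inj: "inj_on col {..<r}" and nz: "c \<otimes> cring_det R r (\<lambda>i j. M (row i) (col j)) \<noteq> \<zero>"
    using r(2) unfolding alive_minor_def by (elim exE conjE) (rule that)
  have row: "\<And>i. i < r \<Longrightarrow> row i < N" and col: "\<And>j. j < r \<Longrightarrow> col j < N" using rc by auto
  have "card (col ` {..<r}) \<le> r" using card_image_le[of "{..<r}" col] by simp
  then have "\<not> {..<N} \<subseteq> col ` {..<r}" using r(1) card_mono[of "col ` {..<r}" "{..<N}"] by auto
  then obtain k where k: "k < N" "k \<notin> col ` {..<r}" by blast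
  define col' where "col' = col(r := k)"
  have col'_old: "col' j = col j" if "j < r" for j using that by (simp add: col'_def)
  have col'_new: "col' r = k" by (simp add: col'_def)
  have col': "col' j < N" if "j < Suc r" for j
    using that col[of j] k(1) by (cases "j = r") (simp_all add: col'_def)
  have inj': "inj_on col' {..<Suc r}"
  proof -
    have "inj_on col' {..<r}"
      using inj by (subst inj_on_cong[where g = col]) (auto simp: col'_old)
    moreover have "col' ` {..<r} = col ` {..<r}"
      by (rule image_cong) (auto simp: col'_old)
    ultimately show ?thesis
      using k(2) by (simp add: lessThan_Suc col'_new)
  qed
  \<comment> \<open>Row \<open>r\<close> of \<open>base\<close> is only a placeholder for the bordering row: by linearity the cofactors are
    the determinants with a unit vector in its place.\<close>
  define base where "base = (\<lambda>i j. M (row i) (col' j))"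
  define unit where "unit = (\<lambda>(l :: nat) (j :: nat). if j = l then \<one> else \<zero>)"
  define cof where "cof l = c \<otimes> cring_det R (Suc r) (base(r := unit l))" for l :: nat
  \<comment> \<open>Entries \<open>row r\<close> may lie out of range, so the placeholder row is replaced by zero.\<close>
  define base' where "base' = base(r := \<lambda>_. \<zero>)"
  have base': "base' i j \<in> carrier R" if "i < Suc r" "j < Suc r" for i j
  proof (cases "i = r")
    case False
    then have "row i < N" using that row by simp
    then show ?thesis using False M col'[OF that(2)] by (simp add: base'_def base_def)
  qed (simp add: base'_def)
  have upd: "base'(r := f) = base(r := f)" for f by (simp add: base'_def)
  have unitc: "unit l j \<in> carrier R" for l j :: nat by (simp add: unit_def)
  have detc: "cring_det R (Suc r) (base(r := unit l)) \<in> carrier R" for l :: nat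
    using base' unitc by (simp only: upd[symmetric]) (intro det_closed, auto)
  have cofc: "cof l \<in> carrier R" for l by (simp add: cof_def c detc)
  have expand: "(\<Oplus>l\<in>{..<Suc r}. M i (col' l) \<otimes> cof l) = \<zero>" if i: "i < N" for i
  proof -
    have Mi: "M i (col' l) \<in> carrier R" if "l < Suc r" for l using M i col' that by simp
    have "\<zero> = c \<otimes> cring_det R (Suc r) (\<lambda>a j. M ((row(r := i)) a) (col' j))"
    proof -
      have rows: "\<forall>a<Suc r. (row(r := i)) a < N" using row i by (auto simp: less_Suc_eq)
      have cols: "\<forall>j<Suc r. col' j < N" using col' by simp
      show ?thesis
      proof (rule ccontr)
        assume "\<zero> \<noteq> c \<otimes> cring_det R (Suc r) (\<lambda>a j. M ((row(r := i)) a) (col' j))"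
        then have "alive_minor (Suc r)"
          unfolding alive_minor_def using rows cols inj' by (intro exI conjI) (assumption | erule not_sym)+
        with r(3) show False by contradiction
      qed
    qed
    also have "(\<lambda>a j. M ((row(r := i)) a) (col' j)) = base'(r := \<lambda>j. M i (col' j))"
      by (auto simp: base'_def base_def fun_eq_iff)
    also have "cring_det R (Suc r) (base'(r := \<lambda>j. M i (col' j))) =
        cring_det R (Suc r) (base'(r := \<lambda>j. \<Oplus>l\<in>{..<Suc r}. M i (col' l) \<otimes> unit l j))"
    proof (rule det_cong)
      fix a j assume "a < Suc r" "j < Suc r"
      moreover have "(\<Oplus>l\<in>{..<Suc r}. M i (col' l) \<otimes> unit l j) = M i (col' j)" if "j < Suc r" for j
      proof -
        have "(\<Oplus>l\<in>{..<Suc r}. M i (col' l) \<otimes> unit l j) =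
            (\<Oplus>l\<in>{..<Suc r}. if j = l then M i (col' l) else \<zero>)"
          using Mi by (intro finsum_cong') (auto simp: unit_def)
        then show ?thesis using that Mi by (simp add: finsum_singleton)
      qed
      ultimately show "(base'(r := \<lambda>j. M i (col' j))) a j =
          (base'(r := \<lambda>j. \<Oplus>l\<in>{..<Suc r}. M i (col' l) \<otimes> unit l j)) a j"
        and "(base'(r := \<lambda>j. \<Oplus>l\<in>{..<Suc r}. M i (col' l) \<otimes> unit l j)) a j \<in> carrier R"
        using base' Mi by auto
    qed
    also have "\<dots> = (\<Oplus>l\<in>{..<Suc r}. M i (col' l) \<otimes> cring_det R (Suc r) (base'(r := unit l)))"
      using base' Mi unitc by (intro det_row_linear) auto
    also have "c \<otimes> \<dots> = (\<Oplus>l\<in>{..<Suc r}. c \<otimes> (M i (col' l) \<otimes> cring_det R (Suc r) (base'(r := unit l))))"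
      using c Mi detc unfolding upd by (intro finsum_rdistr) auto
    also have "\<dots> = (\<Oplus>l\<in>{..<Suc r}. M i (col' l) \<otimes> cof l)"
      using c Mi detc unfolding upd cof_def by (intro finsum_cong') (auto simp: m_lcomm)
    finally show ?thesis by simp
  qed
  define pos where "pos = inv_into {..<Suc r} col'"
  have pos: "pos (col' l) = l" if "l < Suc r" for l
    using inv_into_f_f[OF inj'] that by (simp add: pos_def)
  define v where "v j = (if j \<in> col' ` {..<Suc r} then cof (pos j) else \<zero>)" for j
  show thesis
  proof
    show vc: "v j \<in> carrier R" for j using cofc by (simp add: v_def)
    show "(\<Oplus>j\<in>{..<N}. M i j \<otimes> v j) = \<zero>" if i: "i < N" for i
    proof -
      have "(\<Oplus>j\<in>{..<N}. M i j \<otimes> v j) = (\<Oplus>j\<in>col' ` {..<Suc r}. M i j \<otimes> v j)"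
        using M i vc col' by (intro add.finprod_mono_neutral_cong_right) (auto simp: v_def)
      also have "\<dots> = (\<Oplus>l\<in>{..<Suc r}. M i (col' l) \<otimes> v (col' l))"
        using M i vc col' inj' by (intro finsum_reindex) auto
      also have "\<dots> = (\<Oplus>l\<in>{..<Suc r}. M i (col' l) \<otimes> cof l)"
        using M i cofc col' by (intro finsum_cong') (auto simp: v_def pos)
      finally show ?thesis using expand[OF i] by simp
    qed
    have "v k = cof r"
      using pos[of r] by (auto simp: v_def col'_def image_iff)
    also have "\<dots> = c \<otimes> cring_det R r (base(r := unit r))"
      unfolding cof_def using M row col' by (subst det_unit_last_row) (auto simp: base_def unit_def)
    also have "cring_det R r (base(r := unit r)) = cring_det R r (\<lambda>i j. M (row i) (col j))"
      using M row col by (intro det_cong) (auto simp: base_def col'_def)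
    finally show "\<exists>j<N. v j \<noteq> \<zero>" using nz k by auto
  qed
qed

text \<open>McCoy's theorem. The transpose turns the right kernel vector of the previous lemma into a left one.\<close>

theorem det_nzd_iff_left_kernel_trivial:
  assumes M: "\<And>i j. i < N \<Longrightarrow> j < N \<Longrightarrow> M i j \<in> carrier R"
  shows "non_zero_divisor R (cring_det R N M) \<longleftrightarrow>
    (\<forall>v. (\<forall>i<N. v i \<in> carrier R) \<and> (\<forall>j<N. (\<Oplus>i\<in>{..<N}. v i \<otimes> M i j) = \<zero>) \<longrightarrow> (\<forall>i<N. v i = \<zero>))"
proof (intro iffI allI impI)
  fix v k
  assume "non_zero_divisor R (cring_det R N M)"
    "(\<forall>i<N. v i \<in> carrier R) \<and> (\<forall>j<N. (\<Oplus>i\<in>{..<N}. v i \<otimes> M i j) = \<zero>)" "k < N"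
  then show "v k = \<zero>" using det_nzd_imp_left_kernel_trivial[of N M v k] M by blast
next
  assume triv: "\<forall>v. (\<forall>i<N. v i \<in> carrier R) \<and> (\<forall>j<N. (\<Oplus>i\<in>{..<N}. v i \<otimes> M i j) = \<zero>) \<longrightarrow>
    (\<forall>i<N. v i = \<zero>)"
  have "c = \<zero>" if c: "c \<in> carrier R" "c \<otimes> cring_det R N M = \<zero>" for c
  proof (rule ccontr)
    assume "c \<noteq> \<zero>"
    moreover have "c \<otimes> cring_det R N (\<lambda>i j. M j i) = \<zero>"
      using c by (subst det_transpose) (auto simp: M)
    ultimately obtain v where v: "\<And>j. j < N \<Longrightarrow> v j \<in> carrier R"
      "\<And>i. i < N \<Longrightarrow> (\<Oplus>j\<in>{..<N}. M j i \<otimes> v j) = \<zero>" "\<exists>j<N. v j \<noteq> \<zero>"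
      using det_zero_divisor_imp_right_kernel[of N "\<lambda>i j. M j i" c] M c(1) by blast
    have "(\<Oplus>j\<in>{..<N}. v j \<otimes> M j i) = (\<Oplus>j\<in>{..<N}. M j i \<otimes> v j)" if "i < N" for i
      using M v(1) that by (intro finsum_cong') (auto simp: m_comm)
    then show False using triv v by force
  qed
  then show "non_zero_divisor R (cring_det R N M)"
    using det_closed[of N M, OF M] unfolding non_zero_divisor_def by (metis m_comm)
qed

end

section \<open>Formal derivative and generators of the polynomial ring\<close>

context UP_cring
begin

lemma up_carrierI:
  assumes "\<And>i. g i \<in> carrier R" "\<And>i. N \<le> i \<Longrightarrow> g i = \<zero>"
  shows "g \<in> carrier P"
proof -
  have "bound \<zero> N g" using assms(2) by (intro bound.intro) auto
  then show ?thesis using assms(1) by (auto simp: P_def UP_def)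
qed

lemma coeff_eq: "p \<in> carrier P \<Longrightarrow> coeff P p = p"
  by (simp add: P_def UP_def)

lemma deriv_closed [simp]:
  assumes "p \<in> carrier P"
  shows "up_deriv R p \<in> carrier P"
proof (rule up_carrierI)
  show "up_deriv R p i \<in> carrier R" for i
    using assms by (simp add: up_deriv_def P_def[symmetric])
  show "up_deriv R p i = \<zero>" if "deg R p \<le> i" for i
    using assms that by (simp add: up_deriv_def P_def[symmetric] deg_aboveD)
qed

text \<open>The integer factor is written as a ring element, so that distributivity applies to it.\<close>

lemma coeff_deriv:
  assumes "p \<in> carrier P"
  shows "coeff P (up_deriv R p) i = ([Suc i] \<cdot> \<one>) \<otimes> coeff P p (Suc i)"
proof -
  have "([Suc i] \<cdot> \<one>) \<otimes> coeff P p (Suc i) = [Suc i] \<cdot> coeff P p (Suc i)"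
    using R.add_pow_ldistr[of \<one> "coeff P p (Suc i)" "Suc i"] assms
    by (simp del: R.add.nat_pow_Suc)
  moreover have "coeff P (up_deriv R p) i = [Suc i] \<cdot> coeff P p (Suc i)"
    using coeff_eq[OF deriv_closed[OF assms]] by (simp only: up_deriv_def P_def)
  ultimately show ?thesis by simp
qed

lemma deriv_add:
  assumes "p \<in> carrier P" "q \<in> carrier P"
  shows "up_deriv R (p \<oplus>\<^bsub>P\<^esub> q) = up_deriv R p \<oplus>\<^bsub>P\<^esub> up_deriv R q"
  using assms by (intro up_eqI) (simp_all add: coeff_deriv R.r_distr)

lemma deriv_const:
  assumes "a \<in> carrier R"
  shows "up_deriv R (monom P a 0) = \<zero>\<^bsub>P\<^esub>"
  using assms by (intro up_eqI) (simp_all add: coeff_deriv)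

lemma deriv_X: "up_deriv R (monom P \<one> 1) = \<one>\<^bsub>P\<^esub>"
  by (intro up_eqI) (simp_all add: coeff_deriv)

text \<open>In the coefficient of the product at degree \<open>k + 1\<close> the factor \<open>k + 1\<close> is split as \<open>i + (k + 1 - i)\<close>
in the \<open>i\<close>-th term; the two parts give the two summands of the product rule.\<close>

lemma deriv_mult:
  assumes p: "p \<in> carrier P" and q: "q \<in> carrier P"
  shows "up_deriv R (p \<otimes>\<^bsub>P\<^esub> q) = (up_deriv R p \<otimes>\<^bsub>P\<^esub> q) \<oplus>\<^bsub>P\<^esub> (p \<otimes>\<^bsub>P\<^esub> up_deriv R q)"
proof (rule up_eqI)
  fix k
  define e where "e n = [n] \<cdot> \<one>" for n :: nat
  define t where "t i = coeff P p i \<otimes> coeff P q (Suc k - i)" for i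
  have e: "e n \<in> carrier R" for n by (simp add: e_def)
  have e_add: "e i \<oplus> e j = e (i + j)" for i j by (simp add: e_def R.add.nat_pow_mult)
  have t: "t i \<in> carrier R" for i using p q by (simp add: t_def)
  have "coeff P (up_deriv R (p \<otimes>\<^bsub>P\<^esub> q)) k = e (Suc k) \<otimes> (\<Oplus>i\<in>{..Suc k}. t i)"
    using p q by (simp only: coeff_deriv UP_mult_closed coeff_mult e_def t_def)
  also have "\<dots> = (\<Oplus>i\<in>{..Suc k}. e (Suc k) \<otimes> t i)"
    using e t by (intro R.finsum_rdistr) auto
  also have "\<dots> = (\<Oplus>i\<in>{..Suc k}. e i \<otimes> t i \<oplus> e (Suc k - i) \<otimes> t i)"
    using e t by (intro R.finsum_cong') (auto simp: e_add R.l_distr[symmetric])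
  also have "\<dots> = (\<Oplus>i\<in>{..Suc k}. e i \<otimes> t i) \<oplus> (\<Oplus>i\<in>{..Suc k}. e (Suc k - i) \<otimes> t i)"
    using e t by (intro R.finsum_addf) auto
  also have "(\<Oplus>i\<in>{..Suc k}. e i \<otimes> t i) = (\<Oplus>i\<in>{..k}. e (Suc i) \<otimes> t (Suc i)) \<oplus> e 0 \<otimes> t 0"
    using e t by (intro R.finsum_Suc2) auto
  also have "\<dots> = (\<Oplus>i\<in>{..k}. coeff P (up_deriv R p) i \<otimes> coeff P q (k - i))"
    using e t p q by (simp add: e_def[of 0] R.finsum_closed)
      (intro R.finsum_cong', auto simp: coeff_deriv e_def t_def R.m_assoc)
  also have "(\<Oplus>i\<in>{..Suc k}. e (Suc k - i) \<otimes> t i) =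
      e (Suc k - Suc k) \<otimes> t (Suc k) \<oplus> (\<Oplus>i\<in>{..k}. e (Suc k - i) \<otimes> t i)"
    using e t by (intro R.finsum_Suc) auto
  also have "\<dots> = (\<Oplus>i\<in>{..k}. e (Suc k - i) \<otimes> t i)"
    using e t by (simp add: e_def[of 0] R.finsum_closed)
  also have "\<dots> = (\<Oplus>i\<in>{..k}. coeff P p i \<otimes> coeff P (up_deriv R q) (k - i))"
    using p q e by (intro R.finsum_cong')
      (auto simp: coeff_deriv e_def t_def R.m_lcomm Suc_diff_le simp del: R.add.nat_pow_Suc)
  finally show "coeff P (up_deriv R (p \<otimes>\<^bsub>P\<^esub> q)) k =
      coeff P ((up_deriv R p \<otimes>\<^bsub>P\<^esub> q) \<oplus>\<^bsub>P\<^esub> (p \<otimes>\<^bsub>P\<^esub> up_deriv R q)) k"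
    using p q by simp
qed (use p q in simp_all)

text \<open>The constants and \<open>X\<close> generate the polynomial ring. A claim about derivations thus
has to be checked only for these and for sums and products.\<close>

lemma up_generated_induct [consumes 1, case_names const X add mult]:
  assumes p: "p \<in> carrier P"
    and const: "\<And>a. a \<in> carrier R \<Longrightarrow> Q (monom P a 0)"
    and X: "Q (monom P \<one> 1)"
    and add: "\<And>p q. p \<in> carrier P \<Longrightarrow> q \<in> carrier P \<Longrightarrow> Q p \<Longrightarrow> Q q \<Longrightarrow> Q (p \<oplus>\<^bsub>P\<^esub> q)"
    and mult: "\<And>p q. p \<in> carrier P \<Longrightarrow> q \<in> carrier P \<Longrightarrow> Q p \<Longrightarrow> Q q \<Longrightarrow> Q (p \<otimes>\<^bsub>P\<^esub> q)"
  shows "Q p"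
proof -
  have power: "Q (monom P \<one> n)" for n
  proof (induction n)
    case (Suc n)
    then show ?case using X by (simp only: monom_one_Suc) (intro mult, auto)
  qed (use const[of \<one>] in simp)
  have monom: "Q (monom P a n)" if a: "a \<in> carrier R" for a n
    using mult[OF _ _ const[OF a] power[of n]] a by (simp add: monom_mult[symmetric] del: monom_mult)
  have "Q (\<Oplus>\<^bsub>P\<^esub> i \<in> S. monom P (coeff P p i) i)" if "finite S" for S
    using that
  proof (induction S rule: finite_induct)
    case empty
    then show ?case using const[of \<zero>] by simp
  next
    case (insert i S)
    then show ?case using p monom by (simp add: Pi_def) (intro add, auto)
  qed
  then show ?thesis using up_repr[OF p] by (metis finite_atMost)
qed

end

section \<open>Resultants with a monic polynomial\<close>

context UP_cring
begin

lemma coeff_mult_bounded: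
  assumes u: "u \<in> carrier P" and p: "p \<in> carrier P" and bound: "\<And>t. n \<le> t \<Longrightarrow> coeff P u t = \<zero>"
  shows "coeff P (u \<otimes>\<^bsub>P\<^esub> p) k =
    (\<Oplus>t\<in>{..<n}. if t \<le> k then coeff P u t \<otimes> coeff P p (k - t) else \<zero>)"
proof -
  have "coeff P (u \<otimes>\<^bsub>P\<^esub> p) k = (\<Oplus>t\<in>{..k}. coeff P u t \<otimes> coeff P p (k - t))"
    using u p by simp
  also have "\<dots> = (\<Oplus>t\<in>{..<n}. if t \<le> k then coeff P u t \<otimes> coeff P p (k - t) else \<zero>)"
    using u p bound by (intro R.add.finprod_mono_neutral_cong) (auto simp: not_less)
  finally show ?thesis .
qed

text \<open>Multiplication by a monic polynomial raises the degree by exactly \<open>deg f\<close>: the leading coefficient of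
\<open>s\<close> reappears in the product even when the ring has zero divisors.\<close>

lemma monic_mult_coeff_bound:
  assumes f: "f \<in> carrier P" "coeff P f (deg R f) = \<one>" and s: "s \<in> carrier P"
    and bound: "\<And>i. deg R f + n \<le> i \<Longrightarrow> coeff P (s \<otimes>\<^bsub>P\<^esub> f) i = \<zero>"
    and i: "n \<le> i"
  shows "coeff P s i = \<zero>"
proof (rule ccontr)
  assume ne: "coeff P s i \<noteq> \<zero>"
  define d where "d = deg R s"
  have "i \<le> d" unfolding d_def using ne s by (intro deg_belowI) auto
  have "s \<noteq> \<zero>\<^bsub>P\<^esub>" using ne by auto
  then have lead: "coeff P s d \<noteq> \<zero>" unfolding d_def using s by (rule lcoeff_nonzero)
  have "\<zero> = coeff P (s \<otimes>\<^bsub>P\<^esub> f) (deg R f + d)"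
    using bound i \<open>i \<le> d\<close> by simp
  also have "\<dots> = (\<Oplus>t\<in>{..deg R f + d}. coeff P s t \<otimes> coeff P f (deg R f + d - t))"
    using s f by simp
  also have "\<dots> = (\<Oplus>t\<in>{..deg R f + d}. if d = t then coeff P s t else \<zero>)"
  proof (rule R.finsum_cong')
    fix t
    consider "t < d" | "t = d" | "d < t" by linarith
    then show "coeff P s t \<otimes> coeff P f (deg R f + d - t) = (if d = t then coeff P s t else \<zero>)"
      using s f by cases (auto simp: deg_aboveD d_def)
  qed (use s in auto)
  also have "\<dots> = coeff P s d"
    by (rule R.finsum_singleton) (use s in auto)
  finally show False using lead by simp
qed

text \<open>The remainder is bounded through its coefficients and not through its degree, since the
zero polynomial has degree 0. The polynomial \<open>f\<close> is zero only over the zero ring.\<close>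

lemma monic_division:
  assumes f: "f \<in> carrier P" "coeff P f (deg R f) = \<one>" and g: "g \<in> carrier P"
  obtains q r where "q \<in> carrier P" "r \<in> carrier P" "g = f \<otimes>\<^bsub>P\<^esub> q \<oplus>\<^bsub>P\<^esub> r"
    "\<And>i. deg R f \<le> i \<Longrightarrow> coeff P r i = \<zero>"
proof (cases "f = \<zero>\<^bsub>P\<^esub>")
  case True
  then have "\<one> = \<zero>" using f by simp
  then have "coeff P g i = \<zero>" for i
    using g R.l_one[of "coeff P g i"] by simp
  then show thesis using that[of "\<zero>\<^bsub>P\<^esub>" g] f g by simp
next
  case False
  obtain q r and k :: nat where qr: "q \<in> carrier P" "r \<in> carrier P"
    "coeff P f (deg R f) [^] k \<odot>\<^bsub>P\<^esub> g = f \<otimes>\<^bsub>P\<^esub> q \<oplus>\<^bsub>P\<^esub> r" "r = \<zero>\<^bsub>P\<^esub> \<or> deg R r < deg R f"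
    using long_div_theorem[OF f(1) g False] by blast
  have "coeff P r i = \<zero>" if "deg R f \<le> i" for i
    using qr(2,4) that by (auto simp: deg_aboveD)
  moreover have "g = f \<otimes>\<^bsub>P\<^esub> q \<oplus>\<^bsub>P\<^esub> r" using qr(3) f g by simp
  ultimately show thesis using that qr(1,2) by blast
qed

lemma sylvester_closed:
  assumes "f \<in> carrier P" "q \<in> carrier P"
  shows "up_sylvester R m n f q i j \<in> carrier R"
  using assms by (simp add: up_sylvester_def flip: P_def)

text \<open>The rows of the Sylvester matrix are the coefficients of the shifts of \<open>f\<close> and \<open>q\<close>,
from the highest power of \<open>X\<close> downwards. Thus the entries of \<open>v\<close> have to be the coefficients of \<open>u\<close> and of \<open>w\<close>, both in
reversed order, and column \<open>j\<close> stands for the power \<open>m + n - 1 - j\<close>.\<close>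

lemma sylvester_row_combination:
  assumes f: "f \<in> carrier P" "\<And>i. m < i \<Longrightarrow> coeff P f i = \<zero>"
    and q: "q \<in> carrier P" "\<And>i. n < i \<Longrightarrow> coeff P q i = \<zero>"
    and u: "u \<in> carrier P" "\<And>i. n \<le> i \<Longrightarrow> coeff P u i = \<zero>"
    and w: "w \<in> carrier P" "\<And>i. m \<le> i \<Longrightarrow> coeff P w i = \<zero>"
    and v: "\<And>t. t < n \<Longrightarrow> v (n - 1 - t) = coeff P u t"
      "\<And>t. t < m \<Longrightarrow> v (m + n - 1 - t) = coeff P w t"
    and j: "j < m + n"
  shows "(\<Oplus>i\<in>{..<m + n}. v i \<otimes> up_sylvester R m n f q i j) =
    coeff P (u \<otimes>\<^bsub>P\<^esub> f \<oplus>\<^bsub>P\<^esub> w \<otimes>\<^bsub>P\<^esub> q) (m + n - 1 - j)"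
proof -
  let ?S = "up_sylvester R m n f q" and ?k = "m + n - 1 - j"
  let ?hi = "\<lambda>t. n - 1 - t" and ?lo = "\<lambda>t. m + n - 1 - t"
  have S: "?S i j \<in> carrier R" for i j using f(1) q(1) by (rule sylvester_closed)
  have hi: "{..<n} = ?hi ` {..<n}"
  proof (intro equalityI subsetI)
    fix i assume "i \<in> {..<n}"
    then have "i = ?hi (?hi i)" "?hi i \<in> {..<n}" by auto
    then show "i \<in> ?hi ` {..<n}" by (rule image_eqI)
  qed auto
  have lo: "{n..<m + n} = ?lo ` {..<m}"
  proof (intro equalityI subsetI)
    fix i assume "i \<in> {n..<m + n}"
    then have "i = ?lo (m + n - 1 - i)" "m + n - 1 - i \<in> {..<m}" by auto
    then show "i \<in> ?lo ` {..<m}" by (rule image_eqI)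
  qed auto
  have vhi: "v i \<in> carrier R" if i: "i < n" for i
    using v(1)[of "n - 1 - i"] u(1) i by simp
  have vlo: "v i \<in> carrier R" if i: "n \<le> i" "i < m + n" for i
    using v(2)[of "m + n - 1 - i"] w(1) i by simp
  have row_f: "v (?hi t) \<otimes> ?S (?hi t) j =
      (if t \<le> ?k then coeff P u t \<otimes> coeff P f (?k - t) else \<zero>)" if t: "t < n" for t
  proof -
    have "?S (?hi t) j = (if t \<le> ?k then coeff P f (?k - t) else \<zero>)"
    proof (cases "?hi t \<le> j")
      case True
      then have "j \<le> ?hi t + m \<longleftrightarrow> t \<le> ?k" "m + ?hi t - j = ?k - t" using t j by auto
      then show ?thesis using True t by (simp add: up_sylvester_def flip: P_def)
    next
      case False
      then have "t \<le> ?k" "m < ?k - t" using t j by auto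
      then show ?thesis using False t f(2) by (simp add: up_sylvester_def)
    qed
    then show ?thesis using v(1)[OF t] u(1) by simp
  qed
  have row_q: "v (?lo t) \<otimes> ?S (?lo t) j =
      (if t \<le> ?k then coeff P w t \<otimes> coeff P q (?k - t) else \<zero>)" if t: "t < m" for t
  proof -
    have "?S (?lo t) j = (if t \<le> ?k then coeff P q (?k - t) else \<zero>)"
    proof (cases "?lo t - n \<le> j")
      case True
      then have "j \<le> ?lo t \<longleftrightarrow> t \<le> ?k" "?lo t - j = ?k - t" "\<not> ?lo t < n" using t j by auto
      then show ?thesis using True by (simp add: up_sylvester_def flip: P_def)
    next
      case False
      then have "t \<le> ?k" "n < ?k - t" "\<not> ?lo t < n" using t j by auto
      then show ?thesis using False q(2) by (simp add: up_sylvester_def)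
    qed
    then show ?thesis using v(2)[OF t] w(1) by simp
  qed
  have "{..<m + n} = {..<n} \<union> {n..<m + n}" by auto
  then have "(\<Oplus>i\<in>{..<m + n}. v i \<otimes> ?S i j) =
      (\<Oplus>i\<in>{..<n} \<union> {n..<m + n}. v i \<otimes> ?S i j)" by simp
  also have "\<dots> = (\<Oplus>i\<in>{..<n}. v i \<otimes> ?S i j) \<oplus> (\<Oplus>i\<in>{n..<m + n}. v i \<otimes> ?S i j)"
    using vhi vlo S by (intro R.finsum_Un_disjoint) auto
  also have "(\<Oplus>i\<in>{..<n}. v i \<otimes> ?S i j) = (\<Oplus>i\<in>?hi ` {..<n}. v i \<otimes> ?S i j)"
    by (subst hi) (rule refl)
  also have "\<dots> = (\<Oplus>t\<in>{..<n}. v (?hi t) \<otimes> ?S (?hi t) j)"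
    using vhi S by (intro R.finsum_reindex) (auto simp: inj_on_def)
  also have "\<dots> = (\<Oplus>t\<in>{..<n}. if t \<le> ?k then coeff P u t \<otimes> coeff P f (?k - t) else \<zero>)"
    using u(1) f(1) row_f by (intro R.finsum_cong') auto
  also have "\<dots> = coeff P (u \<otimes>\<^bsub>P\<^esub> f) ?k"
    using u f(1) by (intro coeff_mult_bounded[symmetric]) auto
  also have "(\<Oplus>i\<in>{n..<m + n}. v i \<otimes> ?S i j) = (\<Oplus>i\<in>?lo ` {..<m}. v i \<otimes> ?S i j)"
    by (subst lo) (rule refl)
  also have "\<dots> = (\<Oplus>t\<in>{..<m}. v (?lo t) \<otimes> ?S (?lo t) j)"
    using vlo S by (intro R.finsum_reindex) (auto simp: inj_on_def)
  also have "\<dots> = (\<Oplus>t\<in>{..<m}. if t \<le> ?k then coeff P w t \<otimes> coeff P q (?k - t) else \<zero>)"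
    using w(1) q(1) row_q by (intro R.finsum_cong') auto
  also have "\<dots> = coeff P (w \<otimes>\<^bsub>P\<^esub> q) ?k"
    using w q(1) by (intro coeff_mult_bounded[symmetric]) auto
  finally show ?thesis using u(1) f(1) w(1) q(1) by (simp only: coeff_add UP_mult_closed)
qed

lemma coeff_mult_eq_zero:
  assumes "u \<in> carrier P" "p \<in> carrier P"
    and "\<And>i. a \<le> i \<Longrightarrow> coeff P u i = \<zero>" "\<And>i. b < i \<Longrightarrow> coeff P p i = \<zero>" "a + b \<le> k"
  shows "coeff P (u \<otimes>\<^bsub>P\<^esub> p) k = \<zero>"
proof -
  have "coeff P u t \<otimes> coeff P p (k - t) = \<zero>" for t
    using assms by (cases "a \<le> t") auto
  then show ?thesis using assms(1,2) by (simp add: R.add.finprod_one_eqI)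
qed

text \<open>Vectors in the left kernel of the Sylvester matrix are the pairs \<open>(u, w)\<close> with \<open>u f + w q = 0\<close>, \<open>deg u < n\<close>
and \<open>deg w < m\<close>. Given \<open>g\<close> with \<open>f\<close> dividing \<open>g q\<close>, its remainder \<open>w\<close> modulo \<open>f\<close> extends to such a pair, so a trivial kernel
forces \<open>w = 0\<close>. Given such a pair, \<open>f\<close> divides \<open>w q\<close>; if \<open>q\<close> is a non-zero-divisor modulo \<open>f\<close>, then \<open>f\<close> divides \<open>w\<close>, and
both \<open>w\<close> and \<open>u\<close> vanish for degree reasons. The formal degree \<open>n\<close> of \<open>q\<close> may exceed the actual one.\<close>

theorem monic_resultant_nzd_iff:
  assumes f: "f \<in> carrier P" "coeff P f (deg R f) = \<one>"
    and q: "q \<in> carrier P" and qn: "\<And>i. n < i \<Longrightarrow> coeff P q i = \<zero>"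
  shows "non_zero_divisor R (up_resultant R (deg R f) n f q) \<longleftrightarrow>
    (\<forall>w\<in>carrier P. w \<otimes>\<^bsub>P\<^esub> q \<in> PIdl\<^bsub>P\<^esub> f \<longrightarrow> w \<in> PIdl\<^bsub>P\<^esub> f)"
proof -
  define m where "m = deg R f"
  let ?S = "up_sylvester R m n f q"
  have fm: "coeff P f i = \<zero>" if "m < i" for i using that f(1) by (simp add: m_def deg_aboveD)
  have "non_zero_divisor R (up_resultant R m n f q) \<longleftrightarrow>
    (\<forall>v. (\<forall>i<m + n. v i \<in> carrier R) \<and> (\<forall>j<m + n. (\<Oplus>i\<in>{..<m + n}. v i \<otimes> ?S i j) = \<zero>) \<longrightarrow>
      (\<forall>i<m + n. v i = \<zero>))" (is "_ \<longleftrightarrow> ?trivial")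
    unfolding up_resultant_def using sylvester_closed[OF f(1) q]
    by (intro R.det_nzd_iff_left_kernel_trivial)
  also have "?trivial \<longleftrightarrow> (\<forall>w\<in>carrier P. w \<otimes>\<^bsub>P\<^esub> q \<in> PIdl\<^bsub>P\<^esub> f \<longrightarrow> w \<in> PIdl\<^bsub>P\<^esub> f)"
  proof (intro iffI ballI impI)
    fix g assume triv: ?trivial and g: "g \<in> carrier P" "g \<otimes>\<^bsub>P\<^esub> q \<in> PIdl\<^bsub>P\<^esub> f"
    obtain h w where h: "h \<in> carrier P" and w: "w \<in> carrier P" "g = f \<otimes>\<^bsub>P\<^esub> h \<oplus>\<^bsub>P\<^esub> w"
      "\<And>i. m \<le> i \<Longrightarrow> coeff P w i = \<zero>"
      using monic_division[OF f g(1)] unfolding m_def by metis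
    obtain s where s: "s \<in> carrier P" "g \<otimes>\<^bsub>P\<^esub> q = s \<otimes>\<^bsub>P\<^esub> f"
      using g(2) by (auto simp: cgenideal_def)
    \<comment> \<open>With \<open>g q = s f\<close> and \<open>g = f h + w\<close> one gets \<open>w q = (s - h q) f\<close>.\<close>
    define u where "u = h \<otimes>\<^bsub>P\<^esub> q \<ominus>\<^bsub>P\<^esub> s"
    have u: "u \<in> carrier P" using h q s by (simp add: u_def)
    let ?hqf = "h \<otimes>\<^bsub>P\<^esub> q \<otimes>\<^bsub>P\<^esub> f" and ?sf = "s \<otimes>\<^bsub>P\<^esub> f" and ?wq = "w \<otimes>\<^bsub>P\<^esub> q"
    have c: "?hqf \<in> carrier P" "?sf \<in> carrier P" "?wq \<in> carrier P"
      using f(1) h q w(1) s(1) by simp_all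
    have sf: "?sf = ?hqf \<oplus>\<^bsub>P\<^esub> ?wq"
      unfolding s(2)[symmetric] w(2) using f(1) h q w(1) by (simp add: P.l_distr P.r_distr P.m_ac)
    have "u \<otimes>\<^bsub>P\<^esub> f \<oplus>\<^bsub>P\<^esub> ?wq = (?hqf \<oplus>\<^bsub>P\<^esub> \<ominus>\<^bsub>P\<^esub> ?sf) \<oplus>\<^bsub>P\<^esub> ?wq"
      using f(1) h q s(1) by (simp add: u_def P.minus_eq P.l_distr P.l_minus)
    also have "\<dots> = (?hqf \<oplus>\<^bsub>P\<^esub> ?wq) \<oplus>\<^bsub>P\<^esub> \<ominus>\<^bsub>P\<^esub> ?sf"
      using c by (simp only: P.a_ac P.a_inv_closed P.a_closed)
    also have "\<dots> = \<zero>\<^bsub>P\<^esub>"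
      unfolding sf[symmetric] using c(2) by (rule P.r_neg)
    finally have uw: "u \<otimes>\<^bsub>P\<^esub> f \<oplus>\<^bsub>P\<^esub> w \<otimes>\<^bsub>P\<^esub> q = \<zero>\<^bsub>P\<^esub>" .
    have un: "coeff P u i = \<zero>" if "n \<le> i" for i
    proof (rule monic_mult_coeff_bound[OF f u _ that])
      fix k assume k: "deg R f + n \<le> k"
      have "coeff P (w \<otimes>\<^bsub>P\<^esub> q) k = \<zero>"
        using k by (intro coeff_mult_eq_zero[OF w(1) q w(3) qn]) (simp add: m_def)
      moreover have "coeff P (u \<otimes>\<^bsub>P\<^esub> f \<oplus>\<^bsub>P\<^esub> w \<otimes>\<^bsub>P\<^esub> q) k = \<zero>" by (simp only: uw coeff_zero)
      moreover have "u \<otimes>\<^bsub>P\<^esub> f \<in> carrier P" "w \<otimes>\<^bsub>P\<^esub> q \<in> carrier P" using u f w q by simp_all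
      ultimately show "coeff P (u \<otimes>\<^bsub>P\<^esub> f) k = \<zero>" by (simp only: coeff_add coeff_closed R.r_zero)
    qed
    define v where "v i = (if i < n then coeff P u (n - 1 - i) else coeff P w (m + n - 1 - i))" for i
    have v: "v (n - 1 - t) = coeff P u t" if "t < n" for t using that by (simp add: v_def)
    have v': "v (m + n - 1 - t) = coeff P w t" if "t < m" for t
    proof -
      have "\<not> m + n - 1 - t < n" "m + n - 1 - (m + n - 1 - t) = t" using that by auto
      then show ?thesis by (simp only: v_def if_False)
    qed
    have "(\<Oplus>i\<in>{..<m + n}. v i \<otimes> ?S i j) = \<zero>" if "j < m + n" for j
    proof -
      have "(\<Oplus>i\<in>{..<m + n}. v i \<otimes> ?S i j) =
          coeff P (u \<otimes>\<^bsub>P\<^esub> f \<oplus>\<^bsub>P\<^esub> w \<otimes>\<^bsub>P\<^esub> q) (m + n - 1 - j)"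
        by (rule sylvester_row_combination[OF f(1) fm q qn u un w(1,3) v v' that])
      then show ?thesis by (simp only: uw coeff_zero)
    qed
    moreover have "v i \<in> carrier R" for i using u w(1) by (simp add: v_def)
    ultimately have vz: "v i = \<zero>" if "i < m + n" for i using triv that by blast
    have "coeff P w t = \<zero>" for t
      using vz[of "m + n - 1 - t"] v'[of t] w(3)[of t] by (cases "t < m") auto
    then have "w = \<zero>\<^bsub>P\<^esub>" using w(1) by (intro up_eqI) auto
    then have "g = h \<otimes>\<^bsub>P\<^esub> f" using w(2) h f(1) by (simp add: P.m_comm)
    then show "g \<in> PIdl\<^bsub>P\<^esub> f" using h by (auto simp: cgenideal_def)
  next
    assume nzd: "\<forall>w\<in>carrier P. w \<otimes>\<^bsub>P\<^esub> q \<in> PIdl\<^bsub>P\<^esub> f \<longrightarrow> w \<in> PIdl\<^bsub>P\<^esub> f"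
    show ?trivial
    proof (intro allI impI, elim conjE)
      fix v i0
      assume v: "\<forall>i<m + n. v i \<in> carrier R" and i0: "i0 < m + n"
        and ker: "\<forall>j<m + n. (\<Oplus>i\<in>{..<m + n}. v i \<otimes> ?S i j) = \<zero>"
      define u where "u t = (if t < n then v (n - 1 - t) else \<zero>)" for t
      define w where "w t = (if t < m then v (m + n - 1 - t) else \<zero>)" for t
      have u: "u \<in> carrier P" by (rule up_carrierI[of _ n]) (use v in \<open>auto simp: u_def\<close>)
      have w: "w \<in> carrier P" by (rule up_carrierI[of _ m]) (use v in \<open>auto simp: w_def\<close>)
      have un: "coeff P u i = \<zero>" if "n \<le> i" for i using that by (simp add: coeff_eq[OF u] u_def)
      have wm: "coeff P w i = \<zero>" if "m \<le> i" for i using that by (simp add: coeff_eq[OF w] w_def)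
      have vu: "v (n - 1 - t) = coeff P u t" if "t < n" for t
        using that by (simp add: coeff_eq[OF u] u_def)
      have vw: "v (m + n - 1 - t) = coeff P w t" if "t < m" for t
        using that by (simp add: coeff_eq[OF w] w_def)
      have uf: "u \<otimes>\<^bsub>P\<^esub> f \<in> carrier P" and wq: "w \<otimes>\<^bsub>P\<^esub> q \<in> carrier P"
        using u f w q by simp_all
      have uw: "u \<otimes>\<^bsub>P\<^esub> f \<oplus>\<^bsub>P\<^esub> w \<otimes>\<^bsub>P\<^esub> q = \<zero>\<^bsub>P\<^esub>"
      proof (rule up_eqI)
        fix k
        show "coeff P (u \<otimes>\<^bsub>P\<^esub> f \<oplus>\<^bsub>P\<^esub> w \<otimes>\<^bsub>P\<^esub> q) k = coeff P \<zero>\<^bsub>P\<^esub> k"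
        proof (cases "k < m + n")
          case True
          then have j: "m + n - 1 - k < m + n" and k: "m + n - 1 - (m + n - 1 - k) = k" by auto
          have "coeff P (u \<otimes>\<^bsub>P\<^esub> f \<oplus>\<^bsub>P\<^esub> w \<otimes>\<^bsub>P\<^esub> q) (m + n - 1 - (m + n - 1 - k)) =
              (\<Oplus>i\<in>{..<m + n}. v i \<otimes> ?S i (m + n - 1 - k))"
            by (rule sylvester_row_combination[OF f(1) fm q qn u un w wm vu vw j, symmetric])
          then show ?thesis using ker j by (simp only: k coeff_zero)
        next
          case False
          then have k: "n + m \<le> k" "m + n \<le> k" by linarith+
          have "coeff P (u \<otimes>\<^bsub>P\<^esub> f) k = \<zero>"
            using u f(1) un fm k(1) by (rule coeff_mult_eq_zero)
          moreover have "coeff P (w \<otimes>\<^bsub>P\<^esub> q) k = \<zero>"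
            using w q wm qn k(2) by (rule coeff_mult_eq_zero)
          ultimately show ?thesis by (simp only: coeff_add uf wq coeff_zero R.r_zero R.zero_closed)
        qed
      qed (use uf wq in simp_all)
      have "w \<otimes>\<^bsub>P\<^esub> q \<oplus>\<^bsub>P\<^esub> u \<otimes>\<^bsub>P\<^esub> f = \<zero>\<^bsub>P\<^esub>"
        using uw uf wq by (simp only: P.a_comm)
      then have "w \<otimes>\<^bsub>P\<^esub> q = \<ominus>\<^bsub>P\<^esub> (u \<otimes>\<^bsub>P\<^esub> f)"
        using uf wq by (simp only: P.minus_equality)
      also have "\<dots> = (\<ominus>\<^bsub>P\<^esub> u) \<otimes>\<^bsub>P\<^esub> f"
        using u f(1) by (rule P.l_minus[symmetric])
      finally have "w \<otimes>\<^bsub>P\<^esub> q = (\<ominus>\<^bsub>P\<^esub> u) \<otimes>\<^bsub>P\<^esub> f" .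
      then have "w \<otimes>\<^bsub>P\<^esub> q \<in> PIdl\<^bsub>P\<^esub> f" using u by (auto simp: cgenideal_def)
      then have "w \<in> PIdl\<^bsub>P\<^esub> f" using nzd w by blast
      then obtain s where s: "s \<in> carrier P" "w = s \<otimes>\<^bsub>P\<^esub> f" by (auto simp: cgenideal_def)
      have "coeff P s i = \<zero>" for i
        by (rule monic_mult_coeff_bound[OF f s(1), of 0]) (use wm s(2) in \<open>auto simp: m_def\<close>)
      then have "s = \<zero>\<^bsub>P\<^esub>" using s(1) by (intro up_eqI) auto
      then have w0: "w = \<zero>\<^bsub>P\<^esub>" using s(2) f(1) by simp
      then have "u \<otimes>\<^bsub>P\<^esub> f = \<zero>\<^bsub>P\<^esub>" using uw uf q by simp
      then have "coeff P u i = \<zero>" for i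
        by (intro monic_mult_coeff_bound[OF f u, of 0]) simp_all
      then show "v i0 = \<zero>"
        using vu[of "n - 1 - i0"] vw[of "m + n - 1 - i0"] w0 i0 by (cases "i0 < n") auto
    qed
  qed
  finally show ?thesis by (simp only: m_def)
qed

end

section \<open>Derivations of a residue class ring\<close>

locale up_quotient = UP_cring +
  fixes f
  assumes f_closed [simp]: "f \<in> carrier P"
begin

abbreviation "I \<equiv> PIdl\<^bsub>P\<^esub> f"
abbreviation "A \<equiv> up_quot R f"
abbreviation "res \<equiv> up_residue R f"

lemma I_ideal: "ideal I P"
  by (rule P.cgenideal_ideal) simp

sublocale A: cring A
  using ideal.quotient_is_cring[OF I_ideal P.is_cring] by (simp add: up_quot_def P_def)

sublocale res: ring_hom_cring P A res
proof -
  have "res = (+>\<^bsub>P\<^esub>) I" by (auto simp: up_residue_def P_def)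
  then show "ring_hom_cring P A res"
    using ideal.rcos_ring_hom_cring[OF I_ideal P.is_cring] by (simp add: up_quot_def P_def)
qed

lemma carrier_A: "carrier A = res ` carrier P"
  by (auto simp: up_quot_def up_residue_def P_def FactRing_def A_RCOSETS_def RCOSETS_def
      a_r_coset_def)

lemma res_eq_zero_iff:
  assumes "g \<in> carrier P"
  shows "res g = \<zero>\<^bsub>A\<^esub> \<longleftrightarrow> g \<in> I"
proof -
  have "\<zero>\<^bsub>A\<^esub> = I" by (simp add: up_quot_def P_def FactRing_def)
  moreover have "res g = I +>\<^bsub>P\<^esub> g" by (simp add: up_residue_def P_def)
  ultimately show ?thesis
    using ideal.rcos_const_imp_mem[OF I_ideal assms] P.a_rcos_zero[OF I_ideal, of g] by metis
qed

lemma res_nzd_iff: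
  assumes q: "q \<in> carrier P"
  shows "non_zero_divisor A (res q) \<longleftrightarrow> (\<forall>w\<in>carrier P. w \<otimes>\<^bsub>P\<^esub> q \<in> I \<longrightarrow> w \<in> I)"
proof -
  have eq: "(res q \<otimes>\<^bsub>A\<^esub> res w = \<zero>\<^bsub>A\<^esub> \<or> res w \<otimes>\<^bsub>A\<^esub> res q = \<zero>\<^bsub>A\<^esub>) \<longleftrightarrow> w \<otimes>\<^bsub>P\<^esub> q \<in> I"
    if w: "w \<in> carrier P" for w
  proof -
    have comm: "res q \<otimes>\<^bsub>A\<^esub> res w = res w \<otimes>\<^bsub>A\<^esub> res q"
      using w q by (intro A.m_comm res.hom_closed)
    have hom: "res w \<otimes>\<^bsub>A\<^esub> res q = res (w \<otimes>\<^bsub>P\<^esub> q)" using w q by (rule res.hom_mult[symmetric])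
    have "res (w \<otimes>\<^bsub>P\<^esub> q) = \<zero>\<^bsub>A\<^esub> \<longleftrightarrow> w \<otimes>\<^bsub>P\<^esub> q \<in> I"
      using w q by (intro res_eq_zero_iff P.m_closed)
    then show ?thesis unfolding comm hom by (simp only: disj_absorb)
  qed
  show ?thesis
    unfolding non_zero_divisor_def
  proof (intro iffI conjI ballI impI)
    fix w assume "res q \<in> carrier A \<and> (\<forall>x\<in>carrier A.
        res q \<otimes>\<^bsub>A\<^esub> x = \<zero>\<^bsub>A\<^esub> \<or> x \<otimes>\<^bsub>A\<^esub> res q = \<zero>\<^bsub>A\<^esub> \<longrightarrow> x = \<zero>\<^bsub>A\<^esub>)"
      and w: "w \<in> carrier P" "w \<otimes>\<^bsub>P\<^esub> q \<in> I"
    then have "res w = \<zero>\<^bsub>A\<^esub>" using eq[OF w(1)] res.hom_closed[OF w(1)] by blast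
    then show "w \<in> I" using res_eq_zero_iff[OF w(1)] by blast
  next
    show "res q \<in> carrier A" using q by (rule res.hom_closed)
  next
    fix x assume r: "\<forall>w\<in>carrier P. w \<otimes>\<^bsub>P\<^esub> q \<in> I \<longrightarrow> w \<in> I" and x: "x \<in> carrier A"
      and z: "res q \<otimes>\<^bsub>A\<^esub> x = \<zero>\<^bsub>A\<^esub> \<or> x \<otimes>\<^bsub>A\<^esub> res q = \<zero>\<^bsub>A\<^esub>"
    obtain w where w: "w \<in> carrier P" "x = res w" using x unfolding carrier_A by (elim imageE)
    then show "x = \<zero>\<^bsub>A\<^esub>" using z r eq[OF w(1)] res_eq_zero_iff[OF w(1)] by blast
  qed
qed

lemma res_f [simp]: "res f = \<zero>\<^bsub>A\<^esub>"
  by (simp add: res_eq_zero_iff P.cgenideal_self)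

text \<open>In a commutative ring \<open>m x - x m = 0\<close>, so to be inner means to vanish.\<close>

lemma weakly_separable_poly_iff:
  "weakly_separable_poly R f \<longleftrightarrow>
    (\<forall>d. ring_derivation A ((\<lambda>b. res (monom P b 0)) ` carrier R) d \<longrightarrow>
      (\<forall>x\<in>carrier A. d x = \<zero>\<^bsub>A\<^esub>))"
proof -
  have "inner_derivation A d \<longleftrightarrow> (\<forall>x\<in>carrier A. d x = \<zero>\<^bsub>A\<^esub>)" for d
  proof -
    have "(m \<otimes>\<^bsub>A\<^esub> x) \<ominus>\<^bsub>A\<^esub> (x \<otimes>\<^bsub>A\<^esub> m) = \<zero>\<^bsub>A\<^esub>" if "m \<in> carrier A" "x \<in> carrier A" for m x
      using that by (simp add: A.m_comm A.minus_eq A.r_neg)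
    then show ?thesis unfolding inner_derivation_def by fastforce
  qed
  then show ?thesis
    by (simp add: weakly_separable_poly_def weakly_separable_def P_def)
qed

lemma derivation_chain_rule:
  assumes d: "ring_derivation A ((\<lambda>b. res (monom P b 0)) ` carrier R) d" and p: "p \<in> carrier P"
  shows "d (res p) = res (up_deriv R p) \<otimes>\<^bsub>A\<^esub> d (res (monom P \<one> 1))"
proof -
  let ?a = "d (res (monom P \<one> 1))"
  have dc: "d x \<in> carrier A" if "x \<in> carrier A" for x
    using d that by (auto simp: ring_derivation_def)
  have a: "?a \<in> carrier A" by (intro dc) simp
  show ?thesis
    using p
  proof (induction p rule: up_generated_induct)
    case (const b)
    then have "d (res (monom P b 0)) = \<zero>\<^bsub>A\<^esub>" using d by (auto simp: ring_derivation_def)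
    then show ?case using const a by (simp add: deriv_const)
  next
    case X
    then show ?case using a by (simp only: deriv_X res.hom_one A.l_one)
  next
    case (add p q)
    then have "d (res p \<oplus>\<^bsub>A\<^esub> res q) = d (res p) \<oplus>\<^bsub>A\<^esub> d (res q)"
      using d by (simp add: ring_derivation_def)
    then show ?case using add a by (simp add: deriv_add A.l_distr)
  next
    case (mult p q)
    then have "d (res p \<otimes>\<^bsub>A\<^esub> res q) = (d (res p) \<otimes>\<^bsub>A\<^esub> res q) \<oplus>\<^bsub>A\<^esub> (res p \<otimes>\<^bsub>A\<^esub> d (res q))"
      using d by (simp add: ring_derivation_def)
    then show ?case
      using mult a by (simp add: deriv_mult A.l_distr A.r_distr A.m_ac)
  qed
qed

text \<open>The derivation sends the class of \<open>p\<close> to \<open>p'(x) a\<close>. This is independent of the representative because \<open>(s f)' = s' f + s f'\<close>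
becomes \<open>s(x) f'(x)\<close> modulo \<open>f\<close>, and \<open>a\<close> kills \<open>f'(x)\<close>.\<close>

lemma derivation_of_annihilator:
  assumes a: "a \<in> carrier A" and ann: "res (up_deriv R f) \<otimes>\<^bsub>A\<^esub> a = \<zero>\<^bsub>A\<^esub>"
  obtains d where "ring_derivation A ((\<lambda>b. res (monom P b 0)) ` carrier R) d"
    "\<And>p. p \<in> carrier P \<Longrightarrow> d (res p) = res (up_deriv R p) \<otimes>\<^bsub>A\<^esub> a"
proof -
  have multiple: "res (up_deriv R h) \<otimes>\<^bsub>A\<^esub> a = \<zero>\<^bsub>A\<^esub>" if "h \<in> I" for h
  proof -
    obtain s where s: "s \<in> carrier P" "h = s \<otimes>\<^bsub>P\<^esub> f"
      using \<open>h \<in> I\<close> by (auto simp: cgenideal_def)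
    then have "res (up_deriv R h) \<otimes>\<^bsub>A\<^esub> a = res s \<otimes>\<^bsub>A\<^esub> (res (up_deriv R f) \<otimes>\<^bsub>A\<^esub> a)"
      using a by (simp add: deriv_mult A.m_assoc)
    then show ?thesis using s ann by simp
  qed
  have wd: "res (up_deriv R p) \<otimes>\<^bsub>A\<^esub> a = res (up_deriv R q) \<otimes>\<^bsub>A\<^esub> a"
    if pq: "p \<in> carrier P" "q \<in> carrier P" "res p = res q" for p q
  proof -
    have "p \<ominus>\<^bsub>P\<^esub> q \<in> I"
      using P.quotient_eq_iff_same_a_r_cos[OF I_ideal pq(1,2)] pq(3)
      by (simp add: up_residue_def P_def)
    then have "res (up_deriv R (p \<ominus>\<^bsub>P\<^esub> q)) \<otimes>\<^bsub>A\<^esub> a = \<zero>\<^bsub>A\<^esub>" by (rule multiple)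
    moreover have "(p \<ominus>\<^bsub>P\<^esub> q) \<oplus>\<^bsub>P\<^esub> q = p"
      using pq(1,2) by (simp add: P.minus_eq P.a_assoc P.l_neg)
    then have "up_deriv R p = up_deriv R (p \<ominus>\<^bsub>P\<^esub> q) \<oplus>\<^bsub>P\<^esub> up_deriv R q"
      using deriv_add[of "p \<ominus>\<^bsub>P\<^esub> q" q] pq(1,2) by (simp only: P.minus_closed)
    ultimately show ?thesis
      using a pq(1,2) by (simp add: A.l_distr)
  qed
  have "\<forall>x\<in>carrier A. \<exists>p. p \<in> carrier P \<and> res p = x" by (auto simp: carrier_A)
  from bchoice[OF this] obtain rep
    where rep: "\<And>x. x \<in> carrier A \<Longrightarrow> rep x \<in> carrier P \<and> res (rep x) = x" by auto
  define d where "d x = res (up_deriv R (rep x)) \<otimes>\<^bsub>A\<^esub> a" for x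
  have d: "d (res p) = res (up_deriv R p) \<otimes>\<^bsub>A\<^esub> a" if "p \<in> carrier P" for p
    unfolding d_def using rep[OF res.hom_closed[OF that]] that by (intro wd) simp_all
  have "ring_derivation A ((\<lambda>b. res (monom P b 0)) ` carrier R) d"
    unfolding ring_derivation_def
  proof (intro conjI ballI)
    show "d \<in> carrier A \<rightarrow> carrier A"
    proof
      fix x assume "x \<in> carrier A"
      then have "up_deriv R (rep x) \<in> carrier P" using rep[of x] by simp
      then show "d x \<in> carrier A" using a unfolding d_def by (intro A.m_closed res.hom_closed)
    qed
  next
    fix x y assume "x \<in> carrier A" "y \<in> carrier A"
    then obtain p q where p: "p \<in> carrier P" "x = res p" and q: "q \<in> carrier P" "y = res q"
      unfolding carrier_A by (elim imageE)
    let ?p' = "res (up_deriv R p)" and ?q' = "res (up_deriv R q)"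
    have c: "?p' \<in> carrier A" "?q' \<in> carrier A" "res p \<in> carrier A" "res q \<in> carrier A"
      using p(1) q(1) by simp_all
    have "d (res (p \<oplus>\<^bsub>P\<^esub> q)) = (?p' \<oplus>\<^bsub>A\<^esub> ?q') \<otimes>\<^bsub>A\<^esub> a"
      unfolding d[OF P.a_closed[OF p(1) q(1)]] using p(1) q(1) by (simp add: deriv_add)
    also have "\<dots> = d (res p) \<oplus>\<^bsub>A\<^esub> d (res q)"
      unfolding d[OF p(1)] d[OF q(1)] using c a by (intro A.l_distr)
    finally show "d (x \<oplus>\<^bsub>A\<^esub> y) = d x \<oplus>\<^bsub>A\<^esub> d y"
      using p q by simp
    have "d (res (p \<otimes>\<^bsub>P\<^esub> q)) = (?p' \<otimes>\<^bsub>A\<^esub> res q \<oplus>\<^bsub>A\<^esub> res p \<otimes>\<^bsub>A\<^esub> ?q') \<otimes>\<^bsub>A\<^esub> a"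
      unfolding d[OF P.m_closed[OF p(1) q(1)]] using p(1) q(1) by (simp add: deriv_mult)
    also have "\<dots> = (?p' \<otimes>\<^bsub>A\<^esub> a) \<otimes>\<^bsub>A\<^esub> res q \<oplus>\<^bsub>A\<^esub> res p \<otimes>\<^bsub>A\<^esub> (?q' \<otimes>\<^bsub>A\<^esub> a)"
      using c a by (simp add: A.l_distr A.r_distr A.m_ac)
    finally show "d (x \<otimes>\<^bsub>A\<^esub> y) = (d x \<otimes>\<^bsub>A\<^esub> y) \<oplus>\<^bsub>A\<^esub> (x \<otimes>\<^bsub>A\<^esub> d y)"
      using p q by (simp add: d)
  next
    fix x assume "x \<in> (\<lambda>b. res (monom P b 0)) ` carrier R"
    then obtain b where b: "b \<in> carrier R" "x = res (monom P b 0)" by (elim imageE)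
    then show "d x = \<zero>\<^bsub>A\<^esub>" using a by (simp add: d deriv_const)
  qed
  then show thesis using d by (rule that)
qed

text \<open>An element \<open>a\<close> that annihilates \<open>f'(x)\<close> is the value at \<open>x\<close> of some derivation, and \<open>d x\<close> annihilates \<open>f'(x)\<close> for every derivation \<open>d\<close>,
because \<open>0 = d (f(x)) = f'(x) d x\<close>.\<close>

theorem weakly_separable_iff_deriv_nzd:
  "weakly_separable_poly R f \<longleftrightarrow> non_zero_divisor A (res (up_deriv R f))"
proof
  assume ws: "weakly_separable_poly R f"
  have "a = \<zero>\<^bsub>A\<^esub>" if a: "a \<in> carrier A" "res (up_deriv R f) \<otimes>\<^bsub>A\<^esub> a = \<zero>\<^bsub>A\<^esub>" for a
  proof -
    obtain d where d: "ring_derivation A ((\<lambda>b. res (monom P b 0)) ` carrier R) d"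
      "\<And>p. p \<in> carrier P \<Longrightarrow> d (res p) = res (up_deriv R p) \<otimes>\<^bsub>A\<^esub> a"
      by (rule derivation_of_annihilator[OF a]) (rule that)
    have "a = d (res (monom P \<one> 1))"
      using d(2)[of "monom P \<one> 1"] a(1) by (simp only: monom_closed R.one_closed deriv_X res.hom_one A.l_one)
    also have "\<dots> = \<zero>\<^bsub>A\<^esub>"
      using ws d(1) by (auto simp: weakly_separable_poly_iff)
    finally show ?thesis .
  qed
  then show "non_zero_divisor A (res (up_deriv R f))"
    using A.m_comm[of _ "res (up_deriv R f)"] by (auto simp: non_zero_divisor_def)
next
  assume nzd: "non_zero_divisor A (res (up_deriv R f))"
  show "weakly_separable_poly R f"
    unfolding weakly_separable_poly_iff
  proof (intro allI impI ballI)
    fix d x assume d: "ring_derivation A ((\<lambda>b. res (monom P b 0)) ` carrier R) d" and "x \<in> carrier A"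
    then obtain p where p: "p \<in> carrier P" "x = res p"
      unfolding carrier_A by (elim imageE)
    let ?a = "d (res (monom P \<one> 1))"
    have a: "?a \<in> carrier A"
      using d by (auto simp: ring_derivation_def)
    have "res (monom P \<zero> 0) \<in> (\<lambda>b. res (monom P b 0)) ` carrier R" by (intro imageI) simp
    then have "d (res (monom P \<zero> 0)) = \<zero>\<^bsub>A\<^esub>" using d by (simp only: ring_derivation_def)
    then have "d (res f) = \<zero>\<^bsub>A\<^esub>" by simp
    then have "res (up_deriv R f) \<otimes>\<^bsub>A\<^esub> ?a = \<zero>\<^bsub>A\<^esub>"
      using derivation_chain_rule[OF d f_closed] by simp
    then have "?a = \<zero>\<^bsub>A\<^esub>"
      using nzd a unfolding non_zero_divisor_def by blast
    then show "d x = \<zero>\<^bsub>A\<^esub>" using derivation_chain_rule[OF d p(1)] p by simp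
  qed
qed

end

section \<open>Weak separability and the discriminant\<close>

lemma (in cring) nzd_sign_iff:
  assumes x: "x \<in> carrier R"
  shows "non_zero_divisor R ([((-1 :: int) ^ k)] \<cdot> x) \<longleftrightarrow> non_zero_divisor R x"
proof (cases "even k")
  case True
  then show ?thesis using x by simp
next
  case False
  have "(\<ominus> x) \<otimes> y = \<zero> \<longleftrightarrow> x \<otimes> y = \<zero>" "y \<otimes> (\<ominus> x) = \<zero> \<longleftrightarrow> y \<otimes> x = \<zero>"
    if "y \<in> carrier R" for y
    using x that by (simp_all add: l_minus r_minus)
  then show ?thesis using x False by (simp add: add.int_pow_neg non_zero_divisor_def)
qed

theorem theorem2p2:
  fixes B :: "('a, 'm) ring_scheme" and f :: "nat \<Rightarrow> 'a"
  assumes "cring B"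
    and "up_monic B f"
  shows "(weakly_separable_poly B f \<longleftrightarrow>
            non_zero_divisor (up_quot B f) (up_residue B f (up_deriv B f))) \<and>
         (non_zero_divisor (up_quot B f) (up_residue B f (up_deriv B f)) \<longleftrightarrow>
            non_zero_divisor B (up_disc B f))"
proof -
  interpret B: cring B by fact
  have f: "f \<in> carrier (UP B)" "coeff (UP B) f (deg B f) = \<one>\<^bsub>B\<^esub>"
    using assms(2) by (simp_all add: up_monic_def)
  interpret UP_cring B "UP B" by unfold_locales simp
  interpret up_quotient B "UP B" f by unfold_locales (rule f(1))
  let ?f' = "up_deriv B f"
  have "coeff (UP B) ?f' i = \<zero>\<^bsub>B\<^esub>" if "deg B f - 1 < i" for i
    using that f(1) by (simp add: coeff_deriv deg_aboveD)
  then have "non_zero_divisor B (up_resultant B (deg B f) (deg B f - 1) f ?f') \<longleftrightarrow>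
      non_zero_divisor (up_quot B f) (up_residue B f ?f')"
    using f by (simp only: monic_resultant_nzd_iff deriv_closed res_nzd_iff)
  moreover have "up_resultant B (deg B f) (deg B f - 1) f ?f' \<in> carrier B"
    unfolding up_resultant_def using f(1) by (intro B.det_closed sylvester_closed) simp_all
  ultimately show ?thesis
    by (simp only: weakly_separable_iff_deriv_nzd up_disc_def Let_def B.nzd_sign_iff)
qed

end
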